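(* Let $d\ge 1$, let $B$ be a branching function without extinction with $\|B\|_\infty<\infty$, and let $(\mathbb{V},\mathbb{A})$ be the rooted tree defined by $B$, with branching rate $\mathsf{br}(\mathbb{V})$. Let $\mu$ be a probability measure on $G=\mathsf{GL}(d,\mathbb{R})$ satisfying Conditions 1 (integrability), 2 (strong irreducibility) and 3 (strict positivity) stated in the context, and let $\lambda=\inf_{s\in[0,1]}k(s)$. Let $(\xi_a)_{a\in\mathbb{A}}$ be independent $G$-valued random variables with common law $\mu$, let $\zeta_\infty$ be the limit of the integrated matrix-multiplicative cascade process built from them, and let $\chi\in\mathbb{R}^d$ be the vector with all components equal to $1$. If $$\lambda\,\mathsf{br}(\mathbb{V})>1,$$ then $Z_\infty:=(\chi,\zeta_\infty\chi)=\infty$ almost surely.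
   Context: **Trees.** $\mathbb{N}=\{1,2,3,\ldots\}$, $\mathbb{Z}_+=\{0,1,2,\ldots\}$, $\mathbb{N}_n=\{1,\ldots,n\}$ for $n\ge1$, and $\mathbb{N}_0=\emptyset$. $\mathbb{N}^*$ denotes the set of finite words (including the empty word $\emptyset$) on the alphabet $\mathbb{N}$; $|\mathbf{v}|$ is the length of the word $\mathbf{v}$, and $\mathbf{v}{\upharpoonright}_n$ is the word formed by its first $n$ letters. For $|\mathbf v|\ge1$ the ancestor of $\mathbf{v}$ is $\hat{\mathbf{v}}=\mathbf{v}{\upharpoonright}_{|\mathbf{v}|-1}$. A branching function is a map $B:\mathbb{N}^*\to\mathbb{Z}_+$. It defines a rooted tree with vertex set $\mathbb{V}=\bigcup_{n\ge0}\mathbb{V}^n$, where $\mathbb{V}^0=\{\emptyset\}$ (the root) and, for $n\ge1$, $\mathbb{V}^n=\{v_1\cdots v_n: v_l\in\mathbb{N}_{B(v_1\cdots v_{l-1})},\ l=1,\ldots,n\}$. The edge set $\mathbb{A}$ consists of the edges $a(\mathbf{v})=[\hat{\mathbf{v}},\mathbf{v}]$, $\mathbf{v}\in\mathbb{V}\setminus\{\emptyset\}$. The boundary $\partial\mathbb{V}$ is the set of infinite words all of whose finite prefixes lie in $\mathbb{V}$; $B$ is without extinction if $\partial\mathbb{V}$ is non-trivial (non-empty). For $\mathbf{u},\mathbf{v}\in\partial\mathbb{V}$ let $\mathbf{u}\wedge\mathbf{v}$ be their longest common prefix and $\delta(\mathbf{u},\mathbf{v})=\exp(-|\mathbf{u}\wedge\mathbf{v}|)$,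 which is a distance on $\partial\mathbb{V}$. When $\|B\|_\infty=\sup_{\mathbf{v}\in\mathbb{V}}B(\mathbf{v})<\infty$, the branching rate is $\mathsf{br}(\mathbb{V})=\exp(\dim_H\partial\mathbb{V})$, where $\dim_H$ is the Hausdorff dimension of the compact metric space $(\partial\mathbb{V},\delta)$. **Cascade.** For $\mathbf{v}\in\mathbb{V}$ with $|\mathbf{v}|=n\ge1$, let $a_1,\ldots,a_n$ be the successive edges of the path from the root to $\mathbf{v}$, and put $\xi[\mathbf{v}]=\xi_{a_n}\cdots\xi_{a_1}$. For $n\ge1$, $\psi_n=\sum_{\mathbf{v}\in\mathbb{V}^n}\xi[\mathbf{v}]$ and $\zeta_n=\sum_{k=1}^n\psi_k$. Under Condition 3 the entries are almost surely nonnegative, and $\zeta_\infty=\lim_n\zeta_n$ entrywise, with entries in $[0,\infty]$. $(\cdot,\cdot)$ is the standard scalar product, so $Z_\infty=\sum_{i,j=1}^d\zeta_{\infty,ij}\in[0,\infty]$. **Conditions on $\mu$.** $\|\cdot\|$ is the operator norm on $d\times d$ matrices induced by the $\ell_1$ norm of $\mathbb{R}^d$. $\sigma_\mu$ is the support of $\mu$ in $G$ and $\Sigma_\mu$ the semigroup generated by $\sigma_\mu$. $G_+$ is the set of elements of $G$ with all entries strictly positive, $\overline{G}_+$ the set of those with all entries nonnegative. - Condition 1: $\int_G\|g\|^s\mu(dg)<\infty$ for all $s\in[0,\infty)$. - Condition 2: there is no finite $\Sigma_\mu$-invariant family of proper (non-zero) linear subspaces of $\mathbb{R}^d$. - Condition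 3: $\sigma_\mu\subseteq\overline{G}_+$ and $\mu(\overline{G}_+\setminus G_+)=0$. **The parameter.** For $s\ge0$, $k(s)=\lim_n\left(\int_G\|g\|^s\mu^{\star n}(dg)\right)^{1/n}$, where $\mu^{\star n}$ is the $n$-fold convolution of $\mu$ (the law of a product of $n$ independent random matrices of law $\mu$). Under Conditions 1–3 this limit exists in $[0,\infty)$. *)

theory Defs
  imports "HOL-Probability.Probability"
begin

text \<open>
  Words over the alphabet $\{1,2,\ldots\}$ are lists of naturals. A branching function is any
  function on lists; its values outside the vertex set play no role, so in particular its values
  on lists containing the letter 0 are irrelevant.
\<close>

definition tree_level :: "(nat list \<Rightarrow> nat) \<Rightarrow> nat \<Rightarrow> nat list set" where
  "tree_level B n = {v. length v = n \<and> (\<forall>l<n. v ! l \<in> {1..B (take l v)})}"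

definition tree_vertices :: "(nat list \<Rightarrow> nat) \<Rightarrow> nat list set" where
  "tree_vertices B = (\<Union>n. tree_level B n)"

definition edge_to :: "nat list \<Rightarrow> nat list \<times> nat list" where
  "edge_to v = (butlast v, v)"

definition tree_edges :: "(nat list \<Rightarrow> nat) \<Rightarrow> (nat list \<times> nat list) set" where
  "tree_edges B = edge_to ` (tree_vertices B - {[]})"

definition tree_boundary :: "(nat list \<Rightarrow> nat) \<Rightarrow> (nat \<Rightarrow> nat) set" where
  "tree_boundary B = {u. \<forall>n. map u [0..<n] \<in> tree_vertices B}"

definition common_prefix_length :: "(nat \<Rightarrow> nat) \<Rightarrow> (nat \<Rightarrow> nat) \<Rightarrow> nat" where
  "common_prefix_length u v = (LEAST k. u k \<noteq> v k)"

definition boundary_dist :: "(nat \<Rightarrow> nat) \<Rightarrow> (nat \<Rightarrow> nat) \<Rightarrow> real" where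
  "boundary_dist u v = (if u = v then 0 else exp (- real (common_prefix_length u v)))"

lemma boundary_dist_ultrametric:
  "boundary_dist u w \<le> max (boundary_dist u v) (boundary_dist v w)"
proof (cases "u = w \<or> u = v \<or> v = w")
  case True
  then show ?thesis by (auto simp: boundary_dist_def le_max_iff_disj)
next
  case False
  then have ne: "u \<noteq> w" "u \<noteq> v" "v \<noteq> w" by auto
  let ?k = "common_prefix_length u w"
  have "\<exists>k. u k \<noteq> w k" using ne(1) by auto
  then have "u ?k \<noteq> w ?k" unfolding common_prefix_length_def by (rule LeastI_ex)
  then have "u ?k \<noteq> v ?k \<or> v ?k \<noteq> w ?k" by auto
  then have "common_prefix_length u v \<le> ?k \<or> common_prefix_length v w \<le> ?k"
    unfolding common_prefix_length_def[of u v] common_prefix_length_def[of v w]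
    by (auto intro: Least_le)
  then show ?thesis using ne by (auto simp: boundary_dist_def le_max_iff_disj)
qed

lemma Metric_space_boundary: "Metric_space (tree_boundary B) boundary_dist"
proof
  fix x y z :: "nat \<Rightarrow> nat"
  show nn: "0 \<le> boundary_dist x y" for x y by (simp add: boundary_dist_def)
  show "boundary_dist x y = boundary_dist y x"
    by (simp add: boundary_dist_def common_prefix_length_def eq_commute)
  show "boundary_dist x y = 0 \<longleftrightarrow> x = y" by (simp add: boundary_dist_def)
  show "boundary_dist x z \<le> boundary_dist x y + boundary_dist y z"
    using boundary_dist_ultrametric[of x z y] nn[of x y] nn[of y z] by linarith
qed

definition set_diam :: "('a \<Rightarrow> 'a \<Rightarrow> real) \<Rightarrow> 'a set \<Rightarrow> ennreal" where
  "set_diam d U = (SUP (x, y)\<in>U \<times> U. ennreal (d x y))"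

definition hausdorff_premeasure ::
  "'a set \<Rightarrow> ('a \<Rightarrow> 'a \<Rightarrow> real) \<Rightarrow> real \<Rightarrow> real \<Rightarrow> ennreal" where
  "hausdorff_premeasure S d s \<epsilon> =
     (INF U\<in>{U :: nat \<Rightarrow> 'a set. (\<forall>i. U i \<subseteq> S \<and> set_diam d (U i) \<le> ennreal \<epsilon>) \<and> S \<subseteq> (\<Union>i. U i)}.
        \<Sum>i. ennreal (enn2real (set_diam d (U i)) powr s))"

text \<open>
  The $s$-dimensional Hausdorff measure of the whole metric space \<open>(S, d)\<close>. It is meant for
  \<open>s > 0\<close> only: for \<open>s = 0\<close> the convention \<open>0 powr 0 = 0\<close> makes it different from counting measure.
\<close>

definition hausdorff_measure :: "'a set \<Rightarrow> ('a \<Rightarrow> 'a \<Rightarrow> real) \<Rightarrow> real \<Rightarrow> ennreal" where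
  "hausdorff_measure S d s = (SUP \<epsilon>\<in>{0<..}. hausdorff_premeasure S d s \<epsilon>)"

definition hausdorff_dim :: "'a set \<Rightarrow> ('a \<Rightarrow> 'a \<Rightarrow> real) \<Rightarrow> ennreal" where
  "hausdorff_dim S d = Inf {ennreal s | s. s > 0 \<and> hausdorff_measure S d s = 0}"

text \<open>
  For bounded \<open>B\<close> the dimension of the boundary is finite, so \<open>enn2real\<close> loses nothing.
\<close>

definition branching_rate :: "(nat list \<Rightarrow> nat) \<Rightarrow> real" where
  "branching_rate B = exp (enn2real (hausdorff_dim (tree_boundary B) boundary_dist))"

definition GL :: "(real^'n^'n) set" where
  "GL = {g. invertible g}"

definition GL_borel :: "(real^'n^'n) measure" where
  "GL_borel = restrict_space borel GL"

definition GL_pos :: "(real^'n^'n) set" where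
  "GL_pos = {g \<in> GL. \<forall>i j. g $ i $ j > 0}"

definition GL_nonneg :: "(real^'n^'n) set" where
  "GL_nonneg = {g \<in> GL. \<forall>i j. g $ i $ j \<ge> 0}"

definition l1_norm :: "real^'n \<Rightarrow> real" where
  "l1_norm x = (\<Sum>i\<in>UNIV. \<bar>x $ i\<bar>)"

definition l1_opnorm :: "real^'n^'n \<Rightarrow> real" where
  "l1_opnorm g = (SUP x\<in>{x. l1_norm x = 1}. l1_norm (g *v x))"

definition GL_support :: "(real^'n^'n) measure \<Rightarrow> (real^'n^'n) set" where
  "GL_support \<mu> = {g \<in> GL. \<forall>U. open U \<and> g \<in> U \<longrightarrow> emeasure \<mu> (U \<inter> GL) > 0}"

inductive_set generated_semigroup :: "(real^'n^'n) set \<Rightarrow> (real^'n^'n) set"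
  for S :: "(real^'n^'n) set" where
  gen: "g \<in> S \<Longrightarrow> g \<in> generated_semigroup S"
| mult: "g \<in> generated_semigroup S \<Longrightarrow> h \<in> generated_semigroup S \<Longrightarrow>
    g ** h \<in> generated_semigroup S"

definition moments_condition :: "(real^'n^'n) measure \<Rightarrow> bool" where
  "moments_condition \<mu> \<longleftrightarrow> (\<forall>s\<ge>0. integrable \<mu> (\<lambda>g. l1_opnorm g powr s))"

definition strong_irreducibility :: "(real^'n^'n) measure \<Rightarrow> bool" where
  "strong_irreducibility \<mu> \<longleftrightarrow>
     \<not> (\<exists>F :: (real^'n) set set. finite F \<and> F \<noteq> {} \<and>
          (\<forall>V\<in>F. subspace V \<and> V \<noteq> {0} \<and> V \<noteq> UNIV) \<and>
          (\<forall>g\<in>generated_semigroup (GL_support \<mu>). \<forall>V\<in>F. (\<lambda>x. g *v x) ` V \<in> F))"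

definition strict_positivity :: "(real^'n^'n) measure \<Rightarrow> bool" where
  "strict_positivity \<mu> \<longleftrightarrow>
     GL_support \<mu> \<subseteq> GL_nonneg \<and> emeasure \<mu> (GL_nonneg - GL_pos) = 0"

primrec convolution_power :: "(real^'n^'n) measure \<Rightarrow> nat \<Rightarrow> (real^'n^'n) measure" where
  "convolution_power \<mu> 0 = return GL_borel (mat 1)"
| "convolution_power \<mu> (Suc n) =
     distr (\<mu> \<Otimes>\<^sub>M convolution_power \<mu> n) GL_borel (\<lambda>(g, h). g ** h)"

definition k_rate :: "(real^'n^'n) measure \<Rightarrow> real \<Rightarrow> real" where
  "k_rate \<mu> s =
     lim (\<lambda>n. (\<integral>g. l1_opnorm g powr s \<partial>convolution_power \<mu> n) powr (1 / real n))"

text \<open>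
  \<open>path_product \<xi> v k\<close> is the product along the first \<open>k\<close> edges of the path from the root to \<open>v\<close>,
  later edges multiplying on the left.
\<close>

primrec path_product ::
  "(nat list \<times> nat list \<Rightarrow> real^'n^'n) \<Rightarrow> nat list \<Rightarrow> nat \<Rightarrow> real^'n^'n" where
  "path_product \<xi> v 0 = mat 1"
| "path_product \<xi> v (Suc k) = \<xi> (edge_to (take (Suc k) v)) ** path_product \<xi> v k"

definition cascade_psi ::
  "(nat list \<Rightarrow> nat) \<Rightarrow> (nat list \<times> nat list \<Rightarrow> real^'n^'n) \<Rightarrow> nat \<Rightarrow> real^'n^'n" where
  "cascade_psi B \<xi> n = (\<Sum>v\<in>tree_level B n. path_product \<xi> v (length v))"

definition cascade_zeta ::
  "(nat list \<Rightarrow> nat) \<Rightarrow> (nat list \<times> nat list \<Rightarrow> real^'n^'n) \<Rightarrow> nat \<Rightarrow> real^'n^'n" where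
  "cascade_zeta B \<xi> n = (\<Sum>k=1..n. cascade_psi B \<xi> k)"

definition cascade_zeta_inf ::
  "(nat list \<Rightarrow> nat) \<Rightarrow> (nat list \<times> nat list \<Rightarrow> real^'n^'n) \<Rightarrow> ereal^'n^'n" where
  "cascade_zeta_inf B \<xi> = (\<chi> i j. lim (\<lambda>n. ereal (cascade_zeta B \<xi> n $ i $ j)))"

text \<open>
  The scalar product of the all-ones vector with its image under the limit matrix, written as the
  sum of all entries because the extended reals carry neither matrix products nor inner products.
\<close>

definition cascade_Z_inf ::
  "(nat list \<Rightarrow> nat) \<Rightarrow> (nat list \<times> nat list \<Rightarrow> real^'n^'n) \<Rightarrow> ereal" where
  "cascade_Z_inf B \<xi> = (\<Sum>i\<in>UNIV. \<Sum>j\<in>UNIV. cascade_zeta_inf B \<xi> $ i $ j)"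

end

theory Submission
  imports Defs "HOL-Real_Asymp.Real_Asymp"
begin

text \<open>
  Write \<open>\<iota> g\<close> for the least entry of a matrix \<open>g\<close>. For nonnegative matrices \<open>\<iota>\<close> is
  supermultiplicative, so a product along a path of the tree is bounded below, in every entry, by the
  product of the scalars \<open>\<iota>\<close> of consecutive blocks of the path. Passing to blocks costs
  almost nothing: sandwiching a long product between two strictly positive matrices gives
  \<open>\<iota> (g h k) \<ge> \<iota> g * \<parallel>h\<parallel> * \<iota> k\<close>, so the moments of \<open>\<iota>\<close> over a block of length \<open>N\<close> are at least
  a constant times \<open>k(s) ^ N\<close>, uniformly for \<open>s \<in> [0, 1]\<close> (\<open>min_entry_moment_ge\<close>). This
  reduces the matrix cascade to a scalar one, whose logarithm is a random walk along every path.

  Fix \<open>m\<close> with \<open>1 / \<lambda> < m < br\<close>. The scalar walk obeys a lower bound of Cramer type. Tilting it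
  by the \<open>s \<in> [0, 1]\<close> that minimises its Laplace transform produces a length \<open>L\<close> and a
  threshold \<open>\<tau> \<in> (0, 1]\<close> such that the probability \<open>q\<close> that a block of length \<open>L\<close> has
  least entry at least \<open>\<tau>\<close> satisfies \<open>q * \<tau> * m ^ L > 1\<close> (\<open>supercritical_block_exists\<close>).
  The restriction of \<open>s\<close> to \<open>[0, 1]\<close> corresponds to the restriction \<open>\<tau> \<le> 1\<close>: by duality, the infimum
  of the Laplace transform over this interval is the largest exponential rate of \<open>q * \<tau>\<close> over thresholds
  that are at most 1.

  On the side of the tree, \<open>m < br\<close> means that the boundary has positive Hausdorff measure in
  dimension \<open>ln m\<close>, so the cuts of the tree with edge capacities \<open>m ^ (- n)\<close> at level \<open>n\<close>
  have weight bounded below by some \<open>c > 0\<close> (\<open>min_cut_bounded_below\<close>). By duality of flows and cuts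
  each level carries weights of total mass \<open>c\<close> that give mass at most \<open>m ^ (- \<bar>u\<bar>)\<close> to the
  descendants of \<open>u\<close> (\<open>flow_below_min_cut\<close>).

  Finally, call a block good if its least entry is at least \<open>\<tau>\<close>, and a vertex at level \<open>n * L\<close>
  open if blocks \<open>j, \<dots>, n - 1\<close> on its path are good. The number of open vertices is compared
  with the normalised weight of the open vertices. Two paths that separate in
  block \<open>i\<close> are independent from block \<open>i + 1\<close> on, and since \<open>q * m ^ L > 1\<close> the variance of
  that weight is a convergent geometric sum of order \<open>m ^ (- j * L)\<close>. By Chebyshev there are, except
  on an event of that order, at least \<open>const * q ^ (n - j) * m ^ (n * L)\<close> open vertices
  (\<open>few_open_paths_unlikely\<close>), and each contributes \<open>const * \<tau> ^ (n - j)\<close>. As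
  \<open>q * \<tau> * m ^ L > 1\<close>, the partial sums are unbounded. Ignoring the first \<open>j\<close> blocks is what
  turns positive probability into almost sure divergence: the exceptional event shrinks as
  \<open>j\<close> grows, and the ignored blocks only contribute a positive random factor
  (\<open>AE_cascade_infinite\<close>).
\<close>

section \<open>Positive matrices and their least entry\<close>

definition min_entry :: "real^'n^'n \<Rightarrow> real" where
  "min_entry g = Min (range (\<lambda>(i, j). g $ i $ j))"

lemma le_min_entry_iff: "a \<le> min_entry g \<longleftrightarrow> (\<forall>i j. a \<le> g $ i $ j)"
  unfolding min_entry_def by (subst Min_ge_iff) auto

lemma less_min_entry_iff: "a < min_entry g \<longleftrightarrow> (\<forall>i j. a < g $ i $ j)"
  unfolding min_entry_def by (subst Min_gr_iff) auto

lemma min_entry_le: "min_entry g \<le> g $ i $ j"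
  using le_min_entry_iff[of "min_entry g" g] by blast

text \<open>
  A single summand of each entry of the product is already at least the product of the two least
  entries, so no constant depending on the dimension is lost.
\<close>
lemma min_entry_mult:
  assumes "0 \<le> min_entry g" "0 \<le> min_entry h"
  shows "min_entry g * min_entry h \<le> min_entry (g ** h)"
  unfolding le_min_entry_iff
proof safe
  fix i j
  have e: "min_entry g * min_entry h \<le> g $ i $ k * h $ k $ j" for k
    using assms min_entry_le by (intro mult_mono) (auto simp: le_min_entry_iff)
  have "min_entry g * min_entry h \<le> g $ i $ i * h $ i $ j" by (rule e)
  also have "\<dots> \<le> (\<Sum>k\<in>UNIV. g $ i $ k * h $ k $ j)"
    using assms by (intro member_le_sum) (auto simp: le_min_entry_iff)
  finally show "min_entry g * min_entry h \<le> (g ** h) $ i $ j"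
    by (simp add: matrix_matrix_mult_def)
qed

lemma min_entry_mult_pos: "0 < min_entry g \<Longrightarrow> 0 < min_entry h \<Longrightarrow> 0 < min_entry (g ** h)"
  using min_entry_mult[of g h] mult_pos_pos[of "min_entry g" "min_entry h"] by linarith

lemma l1_opnorm_eq_Max: "l1_opnorm g = Max (range (\<lambda>j. \<Sum>i\<in>UNIV. \<bar>g $ i $ j\<bar>))"
  for g :: "real^'n^'n"
  unfolding l1_opnorm_def
proof (rule cSup_eq_maximum)
  let ?c = "\<lambda>j. \<Sum>i\<in>UNIV. \<bar>g $ i $ j\<bar>"
  have "Max (range ?c) \<in> range ?c" by (intro Max_in) auto
  then obtain j where j: "Max (range ?c) = ?c j" by (rule rangeE)
  have "l1_norm (axis j 1 :: real^'n) = (\<Sum>i\<in>UNIV. if i = j then 1 else 0)"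
    unfolding l1_norm_def by (intro sum.cong) (auto simp: axis_def)
  then have "l1_norm (axis j 1 :: real^'n) = 1" by simp
  moreover have "l1_norm (g *v axis j 1) = ?c j"
    unfolding l1_norm_def by (simp add: matrix_vector_mul_component column_def inner_axis)
  ultimately show "Max (range ?c) \<in> (\<lambda>x. l1_norm (g *v x)) ` {x. l1_norm x = 1}"
    using j by (intro image_eqI[of _ _ "axis j 1"]) auto
next
  let ?c = "\<lambda>j. \<Sum>i\<in>UNIV. \<bar>g $ i $ j\<bar>"
  fix y assume "y \<in> (\<lambda>x. l1_norm (g *v x)) ` {x. l1_norm x = 1}"
  then obtain x :: "real^'n" where x: "l1_norm x = 1" and y: "y = l1_norm (g *v x)" by auto
  have "y \<le> (\<Sum>i\<in>UNIV. \<Sum>j\<in>UNIV. \<bar>g $ i $ j\<bar> * \<bar>x $ j\<bar>)"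
    unfolding y l1_norm_def matrix_vector_mult_def
    by (intro sum_mono) (auto simp: abs_mult[symmetric] intro!: sum_abs)
  also have "\<dots> = (\<Sum>j\<in>UNIV. ?c j * \<bar>x $ j\<bar>)"
    by (subst sum.swap) (simp add: sum_distrib_right)
  also have "\<dots> \<le> (\<Sum>j\<in>UNIV. Max (range ?c) * \<bar>x $ j\<bar>)"
    by (intro sum_mono mult_right_mono Max_ge) auto
  also have "\<dots> = Max (range ?c)"
    using x by (simp add: sum_distrib_left[symmetric] l1_norm_def)
  finally show "y \<le> Max (range ?c)" .
qed

lemma column_sum_le_l1_opnorm: "(\<Sum>i\<in>UNIV. \<bar>g $ i $ j\<bar>) \<le> l1_opnorm g"
  unfolding l1_opnorm_eq_Max by (intro Max_ge) auto

lemma l1_opnorm_nonneg: "0 \<le> l1_opnorm g"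
  by (rule order_trans[OF _ column_sum_le_l1_opnorm[of g undefined]]) (auto intro: sum_nonneg)

lemma l1_opnorm_le_iff: "l1_opnorm g \<le> a \<longleftrightarrow> (\<forall>j. (\<Sum>i\<in>UNIV. \<bar>g $ i $ j\<bar>) \<le> a)"
  unfolding l1_opnorm_eq_Max by (subst Max_le_iff) auto

lemma min_entry_le_l1_opnorm: "min_entry g \<le> l1_opnorm g"
proof -
  have "min_entry g \<le> \<bar>g $ undefined $ undefined\<bar>"
    using min_entry_le[of g undefined undefined] by linarith
  also have "\<dots> \<le> (\<Sum>i\<in>UNIV. \<bar>g $ i $ undefined\<bar>)" by (intro member_le_sum) auto
  finally show ?thesis using column_sum_le_l1_opnorm order_trans by blast
qed

lemma l1_opnorm_mult: "l1_opnorm (g ** h) \<le> l1_opnorm g * l1_opnorm h"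
  unfolding l1_opnorm_le_iff
proof
  fix j
  have "(\<Sum>i\<in>UNIV. \<bar>(g ** h) $ i $ j\<bar>) \<le> (\<Sum>i\<in>UNIV. \<Sum>k\<in>UNIV. \<bar>g $ i $ k\<bar> * \<bar>h $ k $ j\<bar>)"
    unfolding matrix_matrix_mult_def
    by (intro sum_mono) (auto simp: abs_mult[symmetric] intro!: sum_abs)
  also have "\<dots> = (\<Sum>k\<in>UNIV. (\<Sum>i\<in>UNIV. \<bar>g $ i $ k\<bar>) * \<bar>h $ k $ j\<bar>)"
    by (subst sum.swap) (simp add: sum_distrib_right)
  also have "\<dots> \<le> (\<Sum>k\<in>UNIV. l1_opnorm g * \<bar>h $ k $ j\<bar>)"
    by (intro sum_mono mult_right_mono column_sum_le_l1_opnorm) auto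
  also have "\<dots> \<le> l1_opnorm g * l1_opnorm h"
    unfolding sum_distrib_left[symmetric]
    by (intro mult_left_mono column_sum_le_l1_opnorm l1_opnorm_nonneg)
  finally show "(\<Sum>i\<in>UNIV. \<bar>(g ** h) $ i $ j\<bar>) \<le> l1_opnorm g * l1_opnorm h" .
qed

text \<open>
  The least entry of a long product is comparable with its norm as soon as the two outer factors are
  strictly positive: they see every entry of the middle factor, hence its largest column sum. This is
  the only point where norms are turned into lower bounds for entries.
\<close>
lemma min_entry_sandwich:
  assumes g: "0 \<le> min_entry g" and h: "0 \<le> min_entry h" and k: "0 \<le> min_entry k"
  shows "min_entry g * (l1_opnorm h * min_entry k) \<le> min_entry (g ** (h ** k))"
  unfolding le_min_entry_iff
proof safe
  fix i j
  have nn: "0 \<le> g $ i $ j" "0 \<le> h $ i $ j" "0 \<le> k $ i $ j" for i j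
    using g h k by (auto simp: le_min_entry_iff)
  have "l1_opnorm h \<in> range (\<lambda>b. \<Sum>a\<in>UNIV. \<bar>h $ a $ b\<bar>)"
    unfolding l1_opnorm_eq_Max by (intro Max_in) auto
  then obtain b where b: "l1_opnorm h = (\<Sum>a\<in>UNIV. h $ a $ b)"
    using nn by auto
  have "min_entry g * (l1_opnorm h * min_entry k)
      = (\<Sum>a\<in>UNIV. min_entry g * (h $ a $ b * min_entry k))"
    unfolding b by (simp add: sum_distrib_left sum_distrib_right)
  also have "\<dots> \<le> (\<Sum>a\<in>UNIV. g $ i $ a * (\<Sum>c\<in>UNIV. h $ a $ c * k $ c $ j))"
  proof (intro sum_mono mult_mono)
    fix a
    have "h $ a $ b * min_entry k \<le> h $ a $ b * k $ b $ j"
      using nn min_entry_le by (intro mult_left_mono) auto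
    also have "\<dots> \<le> (\<Sum>c\<in>UNIV. h $ a $ c * k $ c $ j)"
      using nn by (intro member_le_sum) auto
    finally show "h $ a $ b * min_entry k \<le> (\<Sum>c\<in>UNIV. h $ a $ c * k $ c $ j)" .
  qed (use nn k min_entry_le in auto)
  finally show "min_entry g * (l1_opnorm h * min_entry k) \<le> (g ** (h ** k)) $ i $ j"
    by (simp add: matrix_matrix_mult_def)
qed

lemma borel_measurable_min_entry [measurable]: "min_entry \<in> borel_measurable borel"
proof -
  have "(\<lambda>g :: real^'n^'n. Min ((\<lambda>p. g $ fst p $ snd p) ` UNIV)) \<in> borel_measurable borel"
    by (intro borel_measurable_Min borel_measurable_continuous_onI continuous_intros) auto
  then show ?thesis unfolding min_entry_def[abs_def] by (simp add: case_prod_beta')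
qed

lemma borel_measurable_l1_opnorm [measurable]: "l1_opnorm \<in> borel_measurable borel"
proof -
  have "(\<lambda>g :: real^'n^'n. Max ((\<lambda>j. \<Sum>i\<in>UNIV. \<bar>g $ i $ j\<bar>) ` UNIV)) \<in> borel_measurable borel"
    by (intro borel_measurable_Max borel_measurable_continuous_onI continuous_intros) auto
  then show ?thesis by (simp add: l1_opnorm_eq_Max[abs_def])
qed

lemma space_GL_borel: "space GL_borel = GL"
  by (simp add: GL_borel_def space_restrict_space)

lemma sets_GL_borelI: "A \<in> sets borel \<Longrightarrow> A \<inter> GL \<in> sets GL_borel"
  unfolding GL_borel_def sets_restrict_space by (subst Int_commute) (rule imageI)

lemma sets_min_entry_ge: "{g \<in> GL. a \<le> min_entry g} \<in> sets GL_borel"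
  for a :: real
proof -
  have "{g \<in> space borel. a \<le> min_entry g} \<in> sets borel" by measurable
  from sets_GL_borelI[OF this] show ?thesis by (simp add: Int_def conj_commute)
qed

lemma sets_min_entry_greater: "{g \<in> GL. a < min_entry g} \<in> sets GL_borel"
  for a :: real
proof -
  have "{g \<in> space borel. a < min_entry g} \<in> sets borel" by measurable
  from sets_GL_borelI[OF this] show ?thesis by (simp add: Int_def conj_commute)
qed

lemma measurable_GL_borelI: "f \<in> measurable borel N \<Longrightarrow> f \<in> measurable GL_borel N"
  unfolding GL_borel_def by (rule measurable_restrict_space1)

lemma mat_1_in_GL: "mat 1 \<in> GL"
  by (simp add: GL_def invertible_def)

lemma GL_mult: "g \<in> GL \<Longrightarrow> h \<in> GL \<Longrightarrow> g ** h \<in> GL"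
  by (simp add: GL_def invertible_mult)

lemma measurable_GL_mult [measurable (raw)]:
  fixes f :: "'a \<Rightarrow> real^'n^'n"
  assumes f: "f \<in> measurable N GL_borel" and h: "h \<in> measurable N GL_borel"
  shows "(\<lambda>x. f x ** h x) \<in> measurable N GL_borel"
  unfolding GL_borel_def
proof (rule measurable_restrict_space2)
  show "(\<lambda>x. f x ** h x) \<in> space N \<rightarrow> GL"
    using measurable_space[OF f] measurable_space[OF h] by (auto simp: space_GL_borel GL_mult)
  have id: "(\<lambda>x. x) \<in> measurable GL_borel (borel :: (real^'n^'n) measure)"
    by (rule measurable_GL_borelI) simp
  have fb: "f \<in> borel_measurable N" "h \<in> borel_measurable N"
    using measurable_compose[OF f id] measurable_compose[OF h id] by auto
  have "continuous_on UNIV (\<lambda>p :: (real^'n^'n) \<times> (real^'n^'n). fst p ** snd p)"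
    unfolding matrix_matrix_mult_def by (intro continuous_intros)
  then show "(\<lambda>x. f x ** h x) \<in> borel_measurable N"
    using borel_measurable_continuous_on[OF _ borel_measurable_Pair[OF fb]] by force
qed

text \<open>
  The complement of the support is covered by countably many null basic open sets, so a matrix drawn
  from \<open>\<mu>\<close> almost surely lies in the support.
\<close>
lemma strict_positivity_AE_min_entry:
  fixes \<mu> :: "(real^'n^'n) measure"
  assumes sets: "sets \<mu> = sets GL_borel" and pos: "strict_positivity \<mu>"
  shows "AE g in \<mu>. 0 < min_entry g"
proof -
  have space: "space \<mu> = GL" using sets_eq_imp_space_eq[OF sets] by (simp add: space_GL_borel)
  have ev: "A \<inter> GL \<in> sets \<mu>" if "A \<in> sets borel" for A
    using sets_GL_borelI[OF that] sets by simp
  obtain \<B> :: "(real^'n^'n) set set" where \<B>: "countable \<B>" "topological_basis \<B>"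
    using ex_countable_basis by blast
  define \<N> where "\<N> = {U \<in> \<B>. emeasure \<mu> (U \<inter> GL) = 0}"
  have "(\<Union>U\<in>\<N>. U \<inter> GL) \<in> null_sets \<mu>"
  proof (rule null_sets_UN')
    show "countable \<N>" using \<B>(1) by (auto simp: \<N>_def)
    fix U assume U: "U \<in> \<N>"
    then have "open U" using \<B>(2) by (auto simp: \<N>_def topological_basis_open)
    then show "U \<inter> GL \<in> null_sets \<mu>" using U ev by (auto simp: \<N>_def null_sets_def)
  qed
  then have 1: "AE g in \<mu>. g \<notin> (\<Union>U\<in>\<N>. U \<inter> GL)" by (rule AE_not_in)
  have supp: "g \<in> (\<Union>U\<in>\<N>. U \<inter> GL)" if g: "g \<in> GL" "g \<notin> GL_support \<mu>" for g
  proof -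
    obtain V where V: "open V" "g \<in> V" "emeasure \<mu> (V \<inter> GL) = 0"
      using g by (auto simp: GL_support_def zero_less_iff_neq_zero)
    obtain U where U: "U \<in> \<B>" "g \<in> U" "U \<subseteq> V"
      using topological_basisE[OF \<B>(2) V(1,2)] by blast
    have "emeasure \<mu> (U \<inter> GL) \<le> emeasure \<mu> (V \<inter> GL)"
      using U(3) ev V(1) by (intro emeasure_mono) auto
    then have "U \<in> \<N>" using U V by (simp add: \<N>_def)
    then show ?thesis using U g by blast
  qed
  have "GL_nonneg - GL_pos \<in> null_sets \<mu>"
  proof -
    have "GL_nonneg - GL_pos = {g \<in> GL. 0 \<le> min_entry g} - {g \<in> GL. 0 < min_entry (g :: real^'n^'n)}"
      by (auto simp: GL_nonneg_def GL_pos_def le_min_entry_iff less_min_entry_iff)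
    also have "\<dots> \<in> sets \<mu>"
      unfolding sets by (intro sets.Diff sets_min_entry_ge sets_min_entry_greater)
    finally have "GL_nonneg - GL_pos \<in> sets \<mu>" .
    then show ?thesis using pos by (simp add: strict_positivity_def null_sets_def)
  qed
  then have 2: "AE g in \<mu>. g \<notin> GL_nonneg - GL_pos" by (rule AE_not_in)
  have sub: "GL_support \<mu> \<subseteq> GL_nonneg" using pos by (simp add: strict_positivity_def)
  from 1 2 AE_space show ?thesis
  proof eventually_elim
    case (elim g)
    then have "g \<in> GL_support \<mu>" using supp space by blast
    then have "g \<in> GL_pos" using sub elim(2) by blast
    then show ?case by (simp add: GL_pos_def less_min_entry_iff)
  qed
qed

section \<open>Convolution powers and their growth rate\<close>

locale matrix_law = prob_space \<mu> for \<mu> :: "(real^'n^'n) measure" +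
  assumes sets_law: "sets \<mu> = sets GL_borel"
begin

abbreviation conv :: "nat \<Rightarrow> (real^'n^'n) measure" where
  "conv \<equiv> convolution_power \<mu>"

lemma space_law: "space \<mu> = GL"
  using sets_eq_imp_space_eq[OF sets_law] by (simp add: space_GL_borel)

lemma sets_conv [simp, measurable_cong]: "sets (conv n) = sets GL_borel"
  by (cases n) auto

lemma space_conv [simp]: "space (conv n) = GL"
  using sets_eq_imp_space_eq[OF sets_conv] by (simp add: space_GL_borel)

lemma measurable_mult_law: "(\<lambda>(g, h). g ** h) \<in> measurable (\<mu> \<Otimes>\<^sub>M conv n) GL_borel"
proof -
  have "(\<lambda>(g, h). g ** h) \<in> measurable (GL_borel \<Otimes>\<^sub>M GL_borel) GL_borel"
    by measurable
  then show ?thesis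
    by (subst measurable_cong_sets[OF sets_pair_measure_cong[OF sets_law sets_conv] refl])
qed

lemma prob_space_conv: "prob_space (conv n)"
proof (induction n)
  case 0
  then show ?case by (simp add: prob_space_return space_GL_borel mat_1_in_GL)
next
  case (Suc n)
  interpret C: prob_space "conv n" by fact
  interpret pair_prob_space \<mu> "conv n" ..
  show ?case unfolding convolution_power.simps by (rule prob_space_distr[OF measurable_mult_law])
qed

sublocale C: prob_space "conv n" for n by (rule prob_space_conv)

lemma nn_integral_conv_Suc:
  assumes f: "f \<in> borel_measurable GL_borel"
  shows "(\<integral>\<^sup>+x. f x \<partial>conv (Suc n)) = (\<integral>\<^sup>+g. \<integral>\<^sup>+h. f (g ** h) \<partial>conv n \<partial>\<mu>)"
proof -
  have m: "(\<lambda>p. f (case p of (g, h) \<Rightarrow> g ** h)) \<in> borel_measurable (\<mu> \<Otimes>\<^sub>M conv n)"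
    by (rule measurable_compose[OF measurable_mult_law f])
  have "(\<integral>\<^sup>+x. f x \<partial>conv (Suc n)) = (\<integral>\<^sup>+p. f (case p of (g, h) \<Rightarrow> g ** h) \<partial>(\<mu> \<Otimes>\<^sub>M conv n))"
    unfolding convolution_power.simps by (rule nn_integral_distr[OF measurable_mult_law]) (simp add: f)
  also have "\<dots> = (\<integral>\<^sup>+g. \<integral>\<^sup>+h. f (g ** h) \<partial>conv n \<partial>\<mu>)"
    by (subst C.nn_integral_fst[OF m, symmetric]) simp
  finally show ?thesis .
qed

lemma measurable_inner_conv:
  assumes f: "f \<in> borel_measurable GL_borel"
  shows "(\<lambda>g. \<integral>\<^sup>+h. f (g ** h) \<partial>conv n) \<in> borel_measurable GL_borel"
proof -
  note f[measurable]
  have "(\<lambda>(g, h). f (g ** h)) \<in> borel_measurable (GL_borel \<Otimes>\<^sub>M GL_borel)" by measurable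
  then have "(\<lambda>(g, h). f (g ** h)) \<in> borel_measurable (GL_borel \<Otimes>\<^sub>M conv n)"
    by (subst measurable_cong_sets[OF sets_pair_measure_cong[OF refl sets_conv] refl])
  then show ?thesis by (rule C.borel_measurable_nn_integral)
qed

text \<open>
  Convolution powers are defined by adding factors on the left. This is the semigroup property, which
  allows a product of \<open>m + n\<close> factors to be cut at any place.
\<close>
lemma nn_integral_conv_add:
  assumes f: "f \<in> borel_measurable GL_borel"
  shows "(\<integral>\<^sup>+x. f x \<partial>conv (m + n)) = (\<integral>\<^sup>+g. \<integral>\<^sup>+h. f (g ** h) \<partial>conv n \<partial>conv m)"
  using f
proof (induction m arbitrary: f)
  case 0
  show ?case
    by (simp add: nn_integral_return[OF _ measurable_inner_conv[OF 0]] space_GL_borel mat_1_in_GL)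
next
  case (Suc m)
  have "(\<integral>\<^sup>+x. f x \<partial>conv (Suc m + n)) = (\<integral>\<^sup>+g. \<integral>\<^sup>+h. f (g ** h) \<partial>conv (m + n) \<partial>\<mu>)"
    using nn_integral_conv_Suc[OF Suc.prems] by simp
  also have "\<dots> = (\<integral>\<^sup>+g. \<integral>\<^sup>+h. \<integral>\<^sup>+k. f (g ** (h ** k)) \<partial>conv n \<partial>conv m \<partial>\<mu>)"
  proof (intro nn_integral_cong Suc.IH)
    fix g assume "g \<in> space \<mu>"
    then have [measurable]: "g \<in> space GL_borel" by (simp add: space_law space_GL_borel)
    note Suc.prems[measurable]
    show "(\<lambda>h. f (g ** h)) \<in> borel_measurable GL_borel" by measurable
  qed
  also have "\<dots> = (\<integral>\<^sup>+g. \<integral>\<^sup>+k. f (g ** k) \<partial>conv n \<partial>conv (Suc m))"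
    by (simp add: nn_integral_conv_Suc[OF measurable_inner_conv[OF Suc.prems]] matrix_mul_assoc
        del: convolution_power.simps)
  finally show ?case .
qed

lemma AE_conv_add:
  assumes P: "{x \<in> GL. P x} \<in> sets GL_borel"
    and ae: "AE g in conv m. AE h in conv n. P (g ** h)"
  shows "AE x in conv (m + n). P x"
proof -
  have i: "indicator {x \<in> GL. \<not> P x} \<in> borel_measurable (GL_borel :: (real^'n^'n) measure)"
  proof -
    have "{x \<in> GL. \<not> P x} = space GL_borel - {x \<in> GL. P x}" by (auto simp: space_GL_borel)
    then show ?thesis using P by (intro borel_measurable_indicator) auto
  qed
  have "emeasure (conv (m + n)) {x \<in> GL. \<not> P x}
     = (\<integral>\<^sup>+x. indicator {x \<in> GL. \<not> P x} x \<partial>conv (m + n))"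
  proof (rule nn_integral_indicator[symmetric])
    have "{x \<in> GL. \<not> P x} = space GL_borel - {x \<in> GL. P x}" by (auto simp: space_GL_borel)
    then show "{x \<in> GL. \<not> P x} \<in> sets (conv (m + n))" using P by auto
  qed
  also have "\<dots> = (\<integral>\<^sup>+g. \<integral>\<^sup>+h. indicator {x \<in> GL. \<not> P x} (g ** h) \<partial>conv n \<partial>conv m)"
    by (rule nn_integral_conv_add[OF i])
  also have "\<dots> = (\<integral>\<^sup>+g. 0 \<partial>conv m)"
  proof (rule nn_integral_cong_AE, rule AE_mp[OF ae], rule AE_I2, rule impI)
    fix g assume g: "AE h in conv n. P (g ** h)"
    have "AE h in conv n. indicator {x \<in> GL. \<not> P x} (g ** h) = (0::ennreal)"
      by (rule AE_mp[OF g]) (auto simp: indicator_def)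
    then have "(\<integral>\<^sup>+h. indicator {x \<in> GL. \<not> P x} (g ** h) \<partial>conv n) = (\<integral>\<^sup>+h. 0 \<partial>conv n)"
      by (rule nn_integral_cong_AE)
    then show "(\<integral>\<^sup>+h. indicator {x \<in> GL. \<not> P x} (g ** h) \<partial>conv n) = 0" by simp
  qed
  finally have z: "emeasure (conv (m + n)) {x \<in> GL. \<not> P x} = 0" by simp
  show ?thesis
  proof (rule AE_I)
    show "{x \<in> space (conv (m + n)). \<not> P x} \<subseteq> {x \<in> GL. \<not> P x}" by simp
    have "{x \<in> GL. \<not> P x} = space GL_borel - {x \<in> GL. P x}" by (auto simp: space_GL_borel)
    then show "{x \<in> GL. \<not> P x} \<in> sets (conv (m + n))" using P by auto
  qed (rule z)
qed

lemma nn_integral_conv_1: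
  assumes f: "f \<in> borel_measurable GL_borel"
  shows "(\<integral>\<^sup>+x. f x \<partial>conv 1) = (\<integral>\<^sup>+x. f x \<partial>\<mu>)"
proof -
  have "(\<integral>\<^sup>+h. f (g ** h) \<partial>conv 0) = f g" if "g \<in> space \<mu>" for g
  proof -
    have [measurable]: "g \<in> space GL_borel" using that by (simp add: space_law space_GL_borel)
    note f[measurable]
    have "(\<lambda>h. f (g ** h)) \<in> borel_measurable GL_borel" by measurable
    then show ?thesis by (simp add: nn_integral_return space_GL_borel mat_1_in_GL)
  qed
  then show ?thesis
    unfolding One_nat_def nn_integral_conv_Suc[OF f] by (rule nn_integral_cong)
qed

end

text \<open>
  Fekete's lemma in multiplicative form: the limit of the roots is also their infimum, which turns
  the asymptotic quantity \<open>k_rate\<close> into a bound valid for every \<open>n\<close>. Working with roots rather than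
  logarithms avoids a case distinction for a vanishing limit.
\<close>
lemma submultiplicative_root_tendsto:
  fixes a :: "nat \<Rightarrow> real"
  assumes nonneg: "\<And>n. 0 \<le> a n" and sub: "\<And>m n. a (m + n) \<le> a m * a n"
  obtains l where "0 \<le> l" "(\<lambda>n. a n powr (1 / real n)) \<longlonglongrightarrow> l"
    "\<And>n. 1 \<le> n \<Longrightarrow> l ^ n \<le> a n"
proof -
  define l where "l = (INF n\<in>{1..}. a n powr (1 / real n))"
  have bdd: "bdd_below ((\<lambda>n. a n powr (1 / real n)) ` {1..})"
    by (intro bdd_belowI[of _ 0]) auto
  have l_le: "l \<le> a n powr (1 / real n)" if "1 \<le> n" for n
    unfolding l_def using that by (intro cINF_lower bdd) auto
  have l0: "0 \<le> l" unfolding l_def by (intro cINF_greatest) auto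
  have lim: "(\<lambda>n. a n powr (1 / real n)) \<longlonglongrightarrow> l"
  proof (rule order_tendstoI)
    fix b assume "b < l"
    then show "\<forall>\<^sub>F n in sequentially. b < a n powr (1 / real n)"
      using l_le by (intro eventually_sequentiallyI[of 1]) (auto intro: less_le_trans)
  next
    fix b assume b: "l < b"
    define c where "c = (l + b) / 2"
    have c: "l < c" "c < b" "0 < c" using b l0 by (auto simp: c_def)
    have "\<exists>N\<in>{1..}. a N powr (1 / real N) < c"
      using c(1) unfolding l_def by (subst (asm) cINF_less_iff[OF _ bdd]) auto
    then obtain N where N: "1 \<le> N" "a N powr (1 / real N) < c" by auto
    have aN: "a N \<le> c ^ N"
    proof -
      have "a N = (a N powr (1 / real N)) ^ N"
        using N(1) nonneg[of N] by (cases "a N = 0") (auto simp: powr_power zero_power)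
      also have "\<dots> \<le> c ^ N" using N(2) by (intro power_mono) auto
      finally show ?thesis .
    qed
    \<comment> \<open>\<open>D\<close> absorbs the remainder of the division of \<open>n\<close> by \<open>N\<close>, so that \<open>a n \<le> D * c ^ n\<close>.\<close>
    define D where "D = 1 + (\<Sum>r<N. a r / c ^ r)"
    have D: "0 < D" unfolding D_def using nonneg c by (intro add_pos_nonneg sum_nonneg) auto
    have small: "a r \<le> D * c ^ r" if "r < N" for r
    proof -
      have "a r / c ^ r \<le> (\<Sum>r<N. a r / c ^ r)"
        using that nonneg c by (intro member_le_sum) auto
      then have "a r / c ^ r \<le> D" by (simp add: D_def)
      then show ?thesis using c by (simp add: field_simps)
    qed
    have all: "a (q * N + r) \<le> D * c ^ (q * N + r)" if "r < N" for q r
    proof (induction q)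
      case 0
      then show ?case using small[OF that] by simp
    next
      case (Suc q)
      have "a (Suc q * N + r) \<le> a N * a (q * N + r)"
        using sub[of N "q * N + r"] by (simp add: add.assoc)
      also have "\<dots> \<le> c ^ N * (D * c ^ (q * N + r))"
        using aN Suc nonneg c by (intro mult_mono) auto
      also have "\<dots> = D * c ^ (Suc q * N + r)" by (simp add: power_add)
      finally show ?case .
    qed
    have bound: "a n powr (1 / real n) \<le> D powr (1 / real n) * c" if "1 \<le> n" for n
    proof -
      have "a n \<le> D * c ^ n"
        using all[of "n mod N" "n div N"] N(1) by simp
      then have "a n powr (1 / real n) \<le> (D * c ^ n) powr (1 / real n)"
        using nonneg by (intro powr_mono2) auto
      also have "\<dots> = D powr (1 / real n) * (c powr real n) powr (1 / real n)"
        using D c by (simp add: powr_mult powr_realpow)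
      also have "(c powr real n) powr (1 / real n) = c"
        using that c by (simp add: powr_powr)
      finally show ?thesis .
    qed
    have "(\<lambda>n. D powr (1 / real n) * c) \<longlonglongrightarrow> D powr 0 * c"
      using D by (intro tendsto_intros lim_1_over_n) auto
    then have "\<forall>\<^sub>F n in sequentially. D powr (1 / real n) * c < b"
      using D c by (intro order_tendstoD(2)) auto
    then show "\<forall>\<^sub>F n in sequentially. a n powr (1 / real n) < b"
      using eventually_ge_at_top[of 1] by eventually_elim (use bound in force)
  qed
  have "l ^ n \<le> a n" if "1 \<le> n" for n
  proof -
    have "l ^ n \<le> (a n powr (1 / real n)) ^ n" using l_le[OF that] l0 by (intro power_mono)
    also have "\<dots> = a n"
      using that nonneg[of n] by (cases "a n = 0") (auto simp: powr_power zero_power)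
    finally show ?thesis .
  qed
  then show thesis using that l0 lim by blast
qed

context matrix_law
begin

lemma conv_1: "conv 1 = \<mu>"
proof (rule measure_eqI)
  show "sets (conv 1) = sets \<mu>" using sets_conv sets_law by simp
  fix A assume "A \<in> sets (conv 1)"
  then have A: "A \<in> sets GL_borel" by (simp only: sets_conv)
  then have "emeasure (conv 1) A = (\<integral>\<^sup>+x. indicator A x \<partial>conv 1)"
    by (intro nn_integral_indicator[symmetric]) (simp only: sets_conv)
  also have "\<dots> = (\<integral>\<^sup>+x. indicator A x \<partial>\<mu>)"
    using A by (intro nn_integral_conv_1) auto
  also have "\<dots> = emeasure \<mu> A"
    using A by (intro nn_integral_indicator) (simp add: sets_law)
  finally show "emeasure (conv 1) A = emeasure \<mu> A" .
qed

lemma measurable_conv: "f \<in> borel_measurable borel \<Longrightarrow> f \<in> borel_measurable (conv n)"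
  by (subst measurable_cong_sets[OF sets_conv refl]) (rule measurable_GL_borelI)

lemma nn_moment_submult:
  assumes s: "0 \<le> s"
  shows "(\<integral>\<^sup>+g. ennreal (l1_opnorm g powr s) \<partial>conv (m + n))
    \<le> (\<integral>\<^sup>+g. ennreal (l1_opnorm g powr s) \<partial>conv m) * (\<integral>\<^sup>+g. ennreal (l1_opnorm g powr s) \<partial>conv n)"
proof -
  let ?N = "\<lambda>g :: real^'n^'n. ennreal (l1_opnorm g powr s)"
  have m0: "?N \<in> borel_measurable borel" by measurable
  have "(\<integral>\<^sup>+g. ?N g \<partial>conv (m + n)) = (\<integral>\<^sup>+g. \<integral>\<^sup>+h. ?N (g ** h) \<partial>conv n \<partial>conv m)"
    by (intro nn_integral_conv_add measurable_GL_borelI m0)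
  also have "\<dots> \<le> (\<integral>\<^sup>+g. \<integral>\<^sup>+h. ?N g * ?N h \<partial>conv n \<partial>conv m)"
  proof (intro nn_integral_mono)
    fix g h :: "real^'n^'n"
    have "l1_opnorm (g ** h) powr s \<le> (l1_opnorm g * l1_opnorm h) powr s"
      using s l1_opnorm_mult l1_opnorm_nonneg by (intro powr_mono2) auto
    then show "?N (g ** h) \<le> ?N g * ?N h"
      by (simp add: powr_mult l1_opnorm_nonneg ennreal_mult[symmetric] ennreal_leI)
  qed
  also have "\<dots> = (\<integral>\<^sup>+g. ?N g \<partial>conv m) * (\<integral>\<^sup>+h. ?N h \<partial>conv n)"
    by (simp add: nn_integral_cmult nn_integral_multc measurable_conv[OF m0])
  finally show ?thesis .
qed

end

locale positive_matrix_law = matrix_law \<mu> for \<mu> :: "(real^'n^'n) measure" +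
  assumes AE_pos: "AE g in \<mu>. 0 < min_entry g"
    and moments: "moments_condition \<mu>"
begin

lemma AE_conv_pos: "AE g in conv (Suc n). 0 < min_entry g"
proof (induction n)
  case 0
  show ?case unfolding conv_1[unfolded One_nat_def] by (rule AE_pos)
next
  case (Suc n)
  have "AE g in conv (1 + Suc n). 0 < min_entry g"
  proof (rule AE_conv_add)
    show "{x \<in> GL. 0 < min_entry (x :: real^'n^'n)} \<in> sets GL_borel"
      by (rule sets_min_entry_greater)
    show "AE g in conv 1. AE h in conv (Suc n). 0 < min_entry (g ** h)"
      unfolding conv_1
    proof (rule AE_mp[OF AE_pos], rule AE_I2, rule impI)
      fix g :: "real^'n^'n" assume g: "0 < min_entry g"
      show "AE h in conv (Suc n). 0 < min_entry (g ** h)"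
      proof (rule AE_mp[OF Suc], rule AE_I2, rule impI)
        fix h :: "real^'n^'n" assume h: "0 < min_entry h"
        show "0 < min_entry (g ** h)"
          by (rule min_entry_mult_pos[OF g h])
      qed
    qed
  qed
  then show ?case by (simp only: One_nat_def add_Suc plus_nat.add_0)
qed

lemma nn_moment_finite:
  assumes s: "0 \<le> s"
  shows "(\<integral>\<^sup>+g. ennreal (l1_opnorm g powr s) \<partial>conv n) < \<infinity>"
proof (induction n)
  case 0
  then show ?case
    by (subst convolution_power.simps, subst nn_integral_return)
       (auto simp: space_GL_borel mat_1_in_GL intro!: measurable_GL_borelI)
next
  case (Suc n)
  have "integrable \<mu> (\<lambda>g. l1_opnorm g powr s)" using moments s by (simp add: moments_condition_def)
  then have 1: "(\<integral>\<^sup>+g. ennreal (l1_opnorm g powr s) \<partial>conv 1) < \<infinity>"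
    unfolding conv_1 by (simp add: integrable_iff_bounded)
  show ?case
    using nn_moment_submult[OF s, of 1 n] 1 Suc
    by (auto simp: ennreal_mult_less_top simp del: convolution_power.simps intro: le_less_trans)
qed

lemma integrable_moment:
  assumes "0 \<le> s"
  shows "integrable (conv n) (\<lambda>g. l1_opnorm g powr s)"
  using nn_moment_finite[OF assms, of n]
  by (auto simp: integrable_iff_bounded intro!: measurable_conv)

lemma moment_submult:
  assumes s: "0 \<le> s"
  shows "(\<integral>g. l1_opnorm g powr s \<partial>conv (m + n))
    \<le> (\<integral>g. l1_opnorm g powr s \<partial>conv m) * (\<integral>g. l1_opnorm g powr s \<partial>conv n)"
proof -
  have *: "ennreal (\<integral>g. l1_opnorm g powr s \<partial>conv n) = (\<integral>\<^sup>+g. ennreal (l1_opnorm g powr s) \<partial>conv n)" for n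
    by (intro nn_integral_eq_integral[symmetric] integrable_moment s) auto
  have nn: "0 \<le> (\<integral>g. l1_opnorm g powr s \<partial>conv n)" for n by simp
  show ?thesis
    using nn_moment_submult[OF s, of m n] nn
    by (simp only: *[symmetric] ennreal_mult[symmetric] ennreal_le_iff mult_nonneg_nonneg)
qed

text \<open>
  The right-hand side is submultiplicative in \<open>n\<close>, so the limit that defines \<open>k_rate\<close> exists and is
  an infimum.
\<close>
lemma k_rate_power_le_moment:
  assumes s: "0 \<le> s"
  shows "0 \<le> k_rate \<mu> s" and "1 \<le> n \<Longrightarrow> k_rate \<mu> s ^ n \<le> (\<integral>g. l1_opnorm g powr s \<partial>conv n)"
proof -
  obtain l where l: "0 \<le> l" "(\<lambda>n. (\<integral>g. l1_opnorm g powr s \<partial>conv n) powr (1 / real n)) \<longlonglongrightarrow> l"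
    "\<And>n. 1 \<le> n \<Longrightarrow> l ^ n \<le> (\<integral>g. l1_opnorm g powr s \<partial>conv n)"
    by (rule submultiplicative_root_tendsto[of "\<lambda>n. \<integral>g. l1_opnorm g powr s \<partial>conv n"])
       (use moment_submult[OF s] in auto)
  have "k_rate \<mu> s = l" unfolding k_rate_def by (rule limI[OF l(2)])
  then show "0 \<le> k_rate \<mu> s" and "1 \<le> n \<Longrightarrow> k_rate \<mu> s ^ n \<le> (\<integral>g. l1_opnorm g powr s \<partial>conv n)"
    using l by auto
qed

lemma k_rate_0_le_1: "k_rate \<mu> 0 \<le> 1"
proof -
  have "k_rate \<mu> 0 ^ 1 \<le> (\<integral>g. l1_opnorm g powr 0 \<partial>conv 1)"
    by (rule k_rate_power_le_moment) auto
  also have "\<dots> \<le> (\<integral>g. 1 \<partial>conv 1)"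
    by (rule integral_mono[OF integrable_moment C.integrable_const]) auto
  also have "\<dots> = 1" using C.prob_space[of 1] by (simp del: One_nat_def)
  finally show ?thesis by simp
qed

lemma integrable_min_1_min_entry: "integrable \<mu> (\<lambda>g. min 1 (min_entry g))"
proof (rule integrable_const_bound)
  show "AE g in \<mu>. norm (min 1 (min_entry g)) \<le> 1"
    using AE_pos by eventually_elim auto
  have "(\<lambda>g :: real^'n^'n. min 1 (min_entry g)) \<in> borel_measurable borel" by measurable
  then show "(\<lambda>g. min 1 (min_entry g)) \<in> borel_measurable \<mu>"
    by (subst measurable_cong_sets[OF sets_law refl]) (rule measurable_GL_borelI)
qed

lemma min_entry_mean_pos: "0 < (\<integral>g. min 1 (min_entry g) \<partial>\<mu>)"
proof -
  have nn: "AE g in \<mu>. 0 \<le> min 1 (min_entry g)" using AE_pos by eventually_elim auto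
  have "(\<integral>g. min 1 (min_entry g) \<partial>\<mu>) \<noteq> 0"
  proof
    assume "(\<integral>g. min 1 (min_entry g) \<partial>\<mu>) = 0"
    then have "AE g in \<mu>. min 1 (min_entry g) = 0"
      by (subst (asm) integral_nonneg_eq_0_iff_AE[OF integrable_min_1_min_entry nn])
    with AE_pos have "AE g in \<mu>. False" by eventually_elim auto
    then show False by (simp add: AE_False)
  qed
  with integral_nonneg_AE[OF nn] show ?thesis by linarith
qed

lemma min_entry_moment_bound:
  assumes s: "0 \<le> s"
  shows "AE g in conv (Suc n). norm (min_entry g powr s) \<le> l1_opnorm g powr s"
  using AE_conv_pos
  by eventually_elim (auto intro!: powr_mono2 s min_entry_le_l1_opnorm)

lemma integrable_min_entry_powr:
  assumes s: "0 \<le> s"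
  shows "integrable (conv (Suc n)) (\<lambda>g. min_entry g powr s)"
proof (rule Bochner_Integration.integrable_bound[OF integrable_moment[OF s]])
  show "AE g in conv (Suc n). norm (min_entry g powr s) \<le> norm (l1_opnorm g powr s)"
    using min_entry_moment_bound[OF s] by simp
  have "(\<lambda>g :: real^'n^'n. min_entry g powr s) \<in> borel_measurable borel" by measurable
  then show "(\<lambda>g. min_entry g powr s) \<in> borel_measurable (conv (Suc n))" by (rule measurable_conv)
qed

text \<open>
  The prefactor comes from the outermost two matrices of the product. It is independent of \<open>n\<close> and of
  \<open>s \<in> [0, 1]\<close> because \<open>min 1 x \<le> x powr s\<close> on this range, and is therefore negligible for long blocks.
\<close>
lemma min_entry_moment_ge:
  assumes s: "0 \<le> s" "s \<le> 1" and n: "1 \<le> n"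
  shows "(\<integral>g. min 1 (min_entry g) \<partial>\<mu>)\<^sup>2 * k_rate \<mu> s ^ n \<le> (\<integral>g. min_entry g powr s \<partial>conv (n + 2))"
proof -
  let ?N = "\<lambda>g :: real^'n^'n. ennreal (l1_opnorm g powr s)"
  let ?I = "\<lambda>g :: real^'n^'n. ennreal (min_entry g powr s)"
  let ?c = "\<integral>g. min 1 (min_entry g) \<partial>\<mu>"
  have [measurable]: "?N \<in> borel_measurable borel" "?I \<in> borel_measurable borel" by measurable
  have mI: "?I \<in> borel_measurable GL_borel" and mN: "?N \<in> borel_measurable (conv n)" for n
    by (auto intro!: measurable_GL_borelI measurable_conv)
  have mI': "?I \<in> borel_measurable (conv n)" for n by (auto intro!: measurable_conv)
  have c: "ennreal ?c \<le> (\<integral>\<^sup>+g. ?I g \<partial>conv 1)"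
  proof -
    have "ennreal ?c = (\<integral>\<^sup>+g. ennreal (min 1 (min_entry g)) \<partial>\<mu>)"
      using AE_pos by (intro nn_integral_eq_integral[symmetric] integrable_min_1_min_entry) auto
    also have "\<dots> \<le> (\<integral>\<^sup>+g. ?I g \<partial>\<mu>)"
    proof (rule nn_integral_mono_AE, rule AE_mp[OF AE_pos], rule AE_I2, rule impI, rule ennreal_leI)
      fix g :: "real^'n^'n" assume g: "0 < min_entry g"
      show "min 1 (min_entry g) \<le> min_entry g powr s"
      proof (cases "min_entry g \<le> 1")
        case True
        then show ?thesis using powr_mono'[of s 1 "min_entry g"] s g by simp
      next
        case False
        then show ?thesis using s by (simp add: ge_one_powr_ge_zero)
      qed
    qed
    finally show ?thesis unfolding conv_1 .
  qed
  have pos1: "AE g in conv 1. 0 < min_entry g" using AE_pos by (simp only: conv_1)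
  have posn: "AE g in conv n. 0 < min_entry g"  using AE_conv_pos[of "n - 1"] unfolding Suc_diff_1[OF n[unfolded One_nat_def Suc_le_eq]] .
  have "ennreal (?c\<^sup>2 * k_rate \<mu> s ^ n) = ennreal ?c * (ennreal (k_rate \<mu> s ^ n) * ennreal ?c)"
    using min_entry_mean_pos k_rate_power_le_moment(1)[OF s(1)]
    by (simp add: ennreal_mult[symmetric] power2_eq_square ac_simps)
  also have "\<dots> \<le> (\<integral>\<^sup>+g. ?I g \<partial>conv 1) * ((\<integral>\<^sup>+h. ?N h \<partial>conv n) * (\<integral>\<^sup>+k. ?I k \<partial>conv 1))"
  proof (intro mult_mono c)
    have "ennreal (k_rate \<mu> s ^ n) \<le> ennreal (\<integral>g. l1_opnorm g powr s \<partial>conv n)"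
      using k_rate_power_le_moment(2)[OF s(1) n] by (rule ennreal_leI)
    also have "\<dots> = (\<integral>\<^sup>+h. ?N h \<partial>conv n)"
      by (intro nn_integral_eq_integral[symmetric] integrable_moment s) auto
    finally show "ennreal (k_rate \<mu> s ^ n) \<le> (\<integral>\<^sup>+h. ?N h \<partial>conv n)" .
  qed auto
  also have "\<dots> = (\<integral>\<^sup>+g. \<integral>\<^sup>+h. \<integral>\<^sup>+k. ?I g * (?N h * ?I k) \<partial>conv 1 \<partial>conv n \<partial>conv 1)"
  proof -
    let ?E = "\<integral>\<^sup>+k. ?I k \<partial>conv 1" and ?A = "\<integral>\<^sup>+h. ?N h \<partial>conv n"
    have 1: "(\<integral>\<^sup>+k. a * (b * ?I k) \<partial>conv 1) = a * (b * ?E)" for a b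
      by (simp only: mult.assoc[symmetric] nn_integral_cmult[OF mI'])
    have 2: "(\<integral>\<^sup>+h. a * (?N h * ?E) \<partial>conv n) = a * (?A * ?E)" for a
      by (simp only: mult.assoc[symmetric] nn_integral_cmult[OF mN] nn_integral_multc[OF borel_measurable_times_ennreal[OF borel_measurable_const mN]])
    show ?thesis unfolding 1 2 by (rule nn_integral_multc[OF mI', symmetric])
  qed
  also have "\<dots> \<le> (\<integral>\<^sup>+g. \<integral>\<^sup>+h. \<integral>\<^sup>+k. ?I (g ** (h ** k)) \<partial>conv 1 \<partial>conv n \<partial>conv 1)"
  proof (rule nn_integral_mono_AE, rule AE_mp[OF pos1], rule AE_I2, rule impI)
    fix g :: "real^'n^'n" assume g: "0 < min_entry g"
    show "(\<integral>\<^sup>+h. \<integral>\<^sup>+k. ?I g * (?N h * ?I k) \<partial>conv 1 \<partial>conv n) \<le> (\<integral>\<^sup>+h. \<integral>\<^sup>+k. ?I (g ** (h ** k)) \<partial>conv 1 \<partial>conv n)"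
    proof (rule nn_integral_mono_AE, rule AE_mp[OF posn], rule AE_I2, rule impI)
      fix h :: "real^'n^'n" assume h: "0 < min_entry h"
      show "(\<integral>\<^sup>+k. ?I g * (?N h * ?I k) \<partial>conv 1) \<le> (\<integral>\<^sup>+k. ?I (g ** (h ** k)) \<partial>conv 1)"
      proof (rule nn_integral_mono_AE, rule AE_mp[OF pos1], rule AE_I2, rule impI)
        fix k :: "real^'n^'n" assume k: "0 < min_entry k"
        have "min_entry g powr s * (l1_opnorm h powr s * min_entry k powr s)
            = (min_entry g * (l1_opnorm h * min_entry k)) powr s"
          using g k l1_opnorm_nonneg[of h] by (simp add: powr_mult)
        also have "\<dots> \<le> min_entry (g ** (h ** k)) powr s"
          using g h k l1_opnorm_nonneg[of h] s by (intro powr_mono2 min_entry_sandwich) auto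
        finally show "?I g * (?N h * ?I k) \<le> ?I (g ** (h ** k))"
          by (simp add: ennreal_mult[symmetric] ennreal_leI)
      qed
    qed
  qed
  also have "\<dots> = (\<integral>\<^sup>+g. \<integral>\<^sup>+h. ?I (g ** h) \<partial>conv (n + 1) \<partial>conv 1)"
  proof (intro nn_integral_cong nn_integral_conv_add[symmetric])
    fix g assume "g \<in> space (conv 1)"
    then have g: "g \<in> space GL_borel" by (simp only: space_conv space_GL_borel)
    have "(\<lambda>h. g ** h) \<in> measurable GL_borel GL_borel" using g by measurable
    then show "(\<lambda>h. ?I (g ** h)) \<in> borel_measurable GL_borel" by (rule measurable_compose[OF _ mI])
  qed
  also have "\<dots> = (\<integral>\<^sup>+g. ?I g \<partial>conv (1 + (n + 1)))"
    by (rule nn_integral_conv_add[OF mI, symmetric])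
  also have "\<dots> = (\<integral>\<^sup>+g. ?I g \<partial>conv (n + 2))" by (simp only: add.commute[of 1 "n + 1"] add.assoc one_add_one)
  also have "\<dots> = ennreal (\<integral>g. min_entry g powr s \<partial>conv (n + 2))"
    using integrable_min_entry_powr[OF s(1), of "Suc n"]
    by (intro nn_integral_eq_integral) (auto simp del: convolution_power.simps)
  finally show ?thesis by (subst (asm) ennreal_le_iff) auto
qed

end

section \<open>A large deviation lower bound for random walks\<close>

lemma abs_exp_diff_le: "\<bar>exp x - exp y\<bar> \<le> \<bar>x - y\<bar> * exp (max x y)" for x y :: real
proof -
  have *: "exp a - exp b \<le> (a - b) * exp a" for a b :: real
  proof -
    have "exp a * (1 + (b - a)) \<le> exp a * exp (b - a)"
      by (intro mult_left_mono exp_ge_add_one_self) auto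
    also have "\<dots> = exp b" by (simp add: exp_add[symmetric])
    finally show ?thesis by (simp add: algebra_simps)
  qed
  show ?thesis
  proof (cases "x \<le> y")
    case True
    then show ?thesis using *[of y x] by (simp add: max_def)
  next
    case False
    then show ?thesis using *[of x y] by (simp add: max_def)
  qed
qed

lemma (in finite_measure) continuous_on_laplace:
  fixes X Y :: "'a \<Rightarrow> real"
  assumes [measurable]: "X \<in> borel_measurable M" "Y \<in> borel_measurable M"
    and X: "\<And>g. \<bar>X g\<bar> \<le> r" and Y: "\<And>g. \<bar>Y g\<bar> \<le> q"
  shows "continuous_on {0..1} (\<lambda>s. \<integral>g. Y g * exp (s * X g) \<partial>M)"
proof -
  have r: "0 \<le> r" and q: "0 \<le> q" using X[of undefined] Y[of undefined] by auto
  let ?K = "q * (r * exp r) * measure M (space M)"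
  have int: "integrable M (\<lambda>g. Y g * exp (s * X g))" if "s \<in> {0..1}" for s
  proof (rule integrable_const_bound[of _ "q * exp r"])
    have "\<bar>s * X g\<bar> \<le> 1 * r" for g unfolding abs_mult using that X by (intro mult_mono) auto
    then have "exp (s * X g) \<le> exp r" for g by (simp add: abs_le_iff)
    then show "AE g in M. norm (Y g * exp (s * X g)) \<le> q * exp r"
      using Y q by (auto simp: abs_mult intro!: mult_mono)
  qed simp
  have "norm ((\<integral>g. Y g * exp (s * X g) \<partial>M) - (\<integral>g. Y g * exp (t * X g) \<partial>M)) \<le> ?K * dist s t"
    if s: "s \<in> {0..1}" and t: "t \<in> {0..1}" for s t
  proof -
    have b: "\<bar>Y g * exp (s * X g) - Y g * exp (t * X g)\<bar> \<le> q * (r * exp r) * dist s t" for g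
    proof -
      have ab: "s * X g \<le> r" "t * X g \<le> r"
      proof -
        have "\<bar>s * X g\<bar> \<le> 1 * r" "\<bar>t * X g\<bar> \<le> 1 * r"
          unfolding abs_mult using s t X by (intro mult_mono; simp)+
        then show "s * X g \<le> r" "t * X g \<le> r" by auto
      qed
      have "\<bar>exp (s * X g) - exp (t * X g)\<bar> \<le> \<bar>s * X g - t * X g\<bar> * exp (max (s * X g) (t * X g))"
        by (rule abs_exp_diff_le)
      also have "\<dots> \<le> (dist s t * r) * exp r"
      proof (intro mult_mono)
        show "\<bar>s * X g - t * X g\<bar> \<le> dist s t * r"
          unfolding left_diff_distrib[symmetric] abs_mult dist_real_def
          by (intro mult_left_mono X) auto
      qed (use ab r in auto)
      finally have "\<bar>exp (s * X g) - exp (t * X g)\<bar> \<le> dist s t * r * exp r" .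
      then have "\<bar>Y g\<bar> * \<bar>exp (s * X g) - exp (t * X g)\<bar> \<le> q * (dist s t * r * exp r)"
        using Y q by (intro mult_mono) auto
      then show ?thesis by (simp add: abs_mult[symmetric] right_diff_distrib ac_simps)
    qed
    have "norm ((\<integral>g. Y g * exp (s * X g) \<partial>M) - (\<integral>g. Y g * exp (t * X g) \<partial>M))
       = norm (\<integral>g. Y g * exp (s * X g) - Y g * exp (t * X g) \<partial>M)"
      using int s t by simp
    also have "\<dots> \<le> (\<integral>g. norm (Y g * exp (s * X g) - Y g * exp (t * X g)) \<partial>M)"
      by (rule integral_norm_bound)
    also have "\<dots> \<le> (\<integral>g. q * (r * exp r) * dist s t \<partial>M)"
      using b int s t by (intro integral_mono) auto
    also have "\<dots> = ?K * dist s t" by simp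
    finally show ?thesis .
  qed
  then have "?K-lipschitz_on {0..1} (\<lambda>s. \<integral>g. Y g * exp (s * X g) \<partial>M)"
    using r q by (intro lipschitz_onI) (auto simp: dist_norm)
  then show ?thesis by (rule lipschitz_on_continuous_on)
qed

text \<open>
  The last two properties are the first order conditions at a minimum of a convex function on
  \<open>[0, 1]\<close>: the derivative vanishes at an interior minimum, and has a sign at an endpoint.
\<close>
lemma (in finite_measure) laplace_minimizer:
  fixes X :: "'a \<Rightarrow> real"
  assumes [measurable]: "X \<in> borel_measurable M" and X: "\<And>g. \<bar>X g\<bar> \<le> r"
  obtains s where "s \<in> {0..1}"
    "\<And>t. t \<in> {0..1} \<Longrightarrow> (\<integral>g. exp (s * X g) \<partial>M) \<le> (\<integral>g. exp (t * X g) \<partial>M)"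
    "s < 1 \<Longrightarrow> 0 \<le> (\<integral>g. X g * exp (s * X g) \<partial>M)"
    "0 < s \<Longrightarrow> (\<integral>g. X g * exp (s * X g) \<partial>M) \<le> 0"
proof -
  let ?\<phi> = "\<lambda>s. \<integral>g. exp (s * X g) \<partial>M" and ?\<psi> = "\<lambda>s. \<integral>g. X g * exp (s * X g) \<partial>M"
  have c\<phi>: "continuous_on {0..1} ?\<phi>"
    using continuous_on_laplace[of X "\<lambda>_. 1" r 1] X by simp
  have c\<psi>: "continuous_on {0..1} ?\<psi>"
    using continuous_on_laplace[of X X r r] X by simp
  have r: "0 \<le> r" using X[of undefined] by auto
  have bnd: "exp (s * X g) \<le> exp r" if "s \<in> {0..1}" for s g
  proof -
    have "\<bar>s * X g\<bar> \<le> 1 * r" unfolding abs_mult using that X by (intro mult_mono) auto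
    then show ?thesis by (simp add: abs_le_iff)
  qed
  have int: "integrable M (\<lambda>g. exp (s * X g))" if "s \<in> {0..1}" for s
    using bnd that by (intro integrable_const_bound[of _ "exp r"]) auto
  have int': "integrable M (\<lambda>g. X g * exp (s * X g))" if "s \<in> {0..1}" for s
    using bnd that X r
    by (intro integrable_const_bound[of _ "r * exp r"]) (auto simp: abs_mult intro!: mult_mono)
  obtain s where s: "s \<in> {0..1}" and min: "\<And>t. t \<in> {0..1} \<Longrightarrow> ?\<phi> s \<le> ?\<phi> t"
    using continuous_attains_inf[OF _ _ c\<phi>] by auto
  \<comment> \<open>Tangents lie below the Laplace transform; the tangent at \<open>t\<close>, evaluated at the minimiser, gives the
    sign of \<open>?\<psi> t\<close>, and continuity of \<open>?\<psi>\<close> transfers it to \<open>s\<close>.\<close>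
  have key: "0 \<le> (t - s) * ?\<psi> t" if t: "t \<in> {0..1}" for t
  proof -
    have "?\<phi> t - (t - s) * ?\<psi> t = (\<integral>g. exp (t * X g) - (t - s) * (X g * exp (t * X g)) \<partial>M)"
      using int[OF t] int'[OF t] by simp
    also have "\<dots> \<le> ?\<phi> s"
    proof (intro integral_mono)
      fix g
      have "exp (t * X g) * (1 + (s - t) * X g) \<le> exp (t * X g) * exp ((s - t) * X g)"
        by (intro mult_left_mono exp_ge_add_one_self) auto
      then show "exp (t * X g) - (t - s) * (X g * exp (t * X g)) \<le> exp (s * X g)"
        by (simp add: exp_add[symmetric] algebra_simps)
    qed (use int[OF t] int'[OF t] int[OF s] in auto)
    finally show ?thesis using min[OF t] by linarith
  qed
  have "0 \<le> ?\<psi> s" if "s < 1"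
  proof (rule tendsto_lowerbound)
    have "(?\<psi> \<longlongrightarrow> ?\<psi> s) (at s within {0..1})" using c\<psi> s by (simp add: continuous_on_def)
    then show "(?\<psi> \<longlongrightarrow> ?\<psi> s) (at s within {s<..<1})"
      by (rule tendsto_within_subset) (use s in auto)
    show "\<forall>\<^sub>F t in at s within {s<..<1}. 0 \<le> ?\<psi> t"
      unfolding eventually_at_filter
    proof (intro always_eventually allI impI)
      fix t assume "t \<in> {s<..<1}"
      then show "0 \<le> ?\<psi> t" using key[of t] s by (auto simp: zero_le_mult_iff)
    qed
    show "at s within {s<..<1} \<noteq> bot" using that by (simp add: at_within_eq_bot_iff)
  qed
  moreover have "?\<psi> s \<le> 0" if "0 < s"
  proof (rule tendsto_upperbound)
    have "(?\<psi> \<longlongrightarrow> ?\<psi> s) (at s within {0..1})" using c\<psi> s by (simp add: continuous_on_def)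
    then show "(?\<psi> \<longlongrightarrow> ?\<psi> s) (at s within {0<..<s})"
      by (rule tendsto_within_subset) (use s in auto)
    show "\<forall>\<^sub>F t in at s within {0<..<s}. ?\<psi> t \<le> 0"
      unfolding eventually_at_filter
    proof (intro always_eventually allI impI)
      fix t assume "t \<in> {0<..<s}"
      then show "?\<psi> t \<le> 0" using key[of t] s by (auto simp: zero_le_mult_iff)
    qed
    show "at s within {0<..<s} \<noteq> bot" using that by (simp add: at_within_eq_bot_iff)
  qed
  ultimately show thesis using that[OF s min] by blast
qed

text \<open>
  By the one-step inequality, \<open>U K x\<close> dominates the probability that a walk started at \<open>x\<close>, with
  \<open>K\<close> steps distributed as \<open>X\<close>, ends in \<open>[0, \<infinity>)\<close>. An inequality rather than an
  equation is what a supermultiplicative functional such as the least entry provides. The number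
  \<open>m\<close> is the drift of the tilted step. The proof is the change of measure of Cramer's theorem combined
  with Chebyshev's inequality, carried out without product spaces: the indicator of \<open>[0, \<infinity>)\<close> is
  minorised by an exponential times a quadratic polynomial, and the steps of the walk map such
  functions to functions of the same form.
\<close>
lemma (in finite_measure) walk_lower_bound:
  fixes X :: "'a \<Rightarrow> real" and U :: "nat \<Rightarrow> real \<Rightarrow> real"
  assumes X_meas [measurable]: "X \<in> borel_measurable M" and X: "\<And>g. \<bar>X g\<bar> \<le> r"
    and mono: "\<And>K. mono (U K)" and U01: "\<And>K x. U K x \<in> {0..1}"
    and U0: "\<And>x. 0 \<le> x \<Longrightarrow> U 0 x = 1"
    and step: "\<And>K x. (\<integral>g. U K (x + X g) \<partial>M) \<le> U (Suc K) x"
    and s: "s \<in> {0..1}"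
    and \<phi>_def: "\<phi> = (\<integral>g. exp (s * X g) \<partial>M)" and \<phi>: "0 < \<phi>"
    and m_def: "m = (\<integral>g. X g * exp (s * X g) \<partial>M) / \<phi>"
    and \<epsilon>: "0 < \<epsilon>" and \<eta>: "0 < \<eta>" "\<eta> < \<phi>"
  shows "\<forall>\<^sub>F K in sequentially. \<eta> ^ K * exp (- s * (m + \<epsilon>) * real K) \<le> U K (- (m - \<epsilon>) * real K)"
proof -
  have r: "0 \<le> r" using X[of undefined] by auto
  have sX: "exp (s * X g) \<le> exp r" for g
  proof -
    have "\<bar>s * X g\<bar> \<le> 1 * r" unfolding abs_mult using s X by (intro mult_mono) auto
    then show ?thesis by (simp add: abs_le_iff)
  qed
  have Xm: "\<bar>X g - m\<bar> \<le> r + \<bar>m\<bar>" for g using X[of g] by linarith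
  have int0: "integrable M (\<lambda>g. exp (s * X g))"
    using sX by (intro integrable_const_bound[of _ "exp r"]) auto
  have intX: "integrable M (\<lambda>g. X g * exp (s * X g))"
    using sX X r
    by (intro integrable_const_bound[of _ "r * exp r"]) (auto simp: abs_mult intro!: mult_mono)
  have int1: "integrable M (\<lambda>g. (X g - m) * exp (s * X g))"
    using sX Xm r
    by (intro integrable_const_bound[of _ "(r + \<bar>m\<bar>) * exp r"]) (auto simp: abs_mult intro!: mult_mono)
  have int2: "integrable M (\<lambda>g. (X g - m)\<^sup>2 * exp (s * X g))"
  proof (rule integrable_const_bound[of _ "(r + \<bar>m\<bar>)\<^sup>2 * exp r"])
    have "(X g - m)\<^sup>2 \<le> (r + \<bar>m\<bar>)\<^sup>2" for g
      using power_mono[OF Xm[of g], of 2] by simp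
    then show "AE g in M. norm ((X g - m)\<^sup>2 * exp (s * X g)) \<le> (r + \<bar>m\<bar>)\<^sup>2 * exp r"
      using sX by (auto simp: abs_mult intro!: mult_mono)
  qed simp
  define v where "v = (\<integral>g. (X g - m)\<^sup>2 * exp (s * X g) \<partial>M) / \<phi>"
  have I1: "(\<integral>g. (X g - m) * exp (s * X g) \<partial>M) = 0"
  proof -
    have "(\<integral>g. (X g - m) * exp (s * X g) \<partial>M) = (\<integral>g. X g * exp (s * X g) \<partial>M) - m * \<phi>"
      using int0 intX by (simp add: left_diff_distrib \<phi>_def)
    then show ?thesis using \<phi> by (simp add: m_def)
  qed
  have I2: "(\<integral>g. (X g - m)\<^sup>2 * exp (s * X g) \<partial>M) = \<phi> * v"
    using \<phi> by (simp add: v_def)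
  have U_meas [measurable]: "U K \<in> borel_measurable borel" for K
    by (rule borel_measurable_mono[OF mono])
  have main: "\<phi> ^ K * exp (- s * (m + \<epsilon>) * real K) * (1 - v / (real K * \<epsilon>\<^sup>2)) \<le> U K (- (m - \<epsilon>) * real K)"
    if K: "1 \<le> K" for K
  proof -
    define D where "D = real K * \<epsilon>"
    have D: "0 < D" using K \<epsilon> by (simp add: D_def)
    \<comment> \<open>\<open>L 0\<close> is the minorant of the indicator; it is positive only on \<open>(0, 2 * D)\<close>, where the
      first factor keeps it below 1. \<open>L n\<close> is its image under \<open>n\<close> steps: the quadratic term is recentred
      by the drift and gains the tilted variance \<open>v\<close> at every step.\<close>
    define L where "L n x = exp (- 2 * s * D) * \<phi> ^ n * exp (s * x) *
      (1 - ((x + real n * m - D)\<^sup>2 + real n * v) / D\<^sup>2)" for n x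
    have "L n x \<le> U n x" for n x
    proof (induction n arbitrary: x)
      case 0
      have L0: "L 0 x = exp (s * (x - 2 * D)) * (1 - (x - D)\<^sup>2 / D\<^sup>2)"
        by (simp add: L_def exp_add[symmetric] algebra_simps)
      show ?case
      proof (cases "0 \<le> x \<and> x \<le> 2 * D")
        case True
        have "L 0 x \<le> 1 * 1"
          unfolding L0
        proof (rule mult_mono')
          show "exp (s * (x - 2 * D)) \<le> 1"
            using True s by (auto simp: mult_le_0_iff)
          have "(x - D)\<^sup>2 \<le> D\<^sup>2" using True by (intro power2_le_iff_abs_le[THEN iffD2]) auto
          then show "0 \<le> 1 - (x - D)\<^sup>2 / D\<^sup>2" using D by (simp add: field_simps)
        qed auto
        then show ?thesis using U0[of x] True by simp
      next
        case False
        then have "D \<le> \<bar>x - D\<bar>" using D by auto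
        then have "D\<^sup>2 \<le> (x - D)\<^sup>2" using D abs_le_square_iff[of D "x - D"] by simp
        then have "L 0 x \<le> 0"
          unfolding L0 using D by (auto simp: mult_le_0_iff field_simps)
        also have "0 \<le> U 0 x" using U01[of 0 x] by simp
        finally show ?thesis .
      qed
    next
      case (Suc n)
      let ?c = "exp (- 2 * s * D) * \<phi> ^ n * exp (s * x)" and ?z = "x + real (Suc n) * m - D"
      have L_eq: "L n (x + X g) = ?c * (exp (s * X g)
        - ((X g - m)\<^sup>2 * exp (s * X g) + 2 * ?z * ((X g - m) * exp (s * X g))
           + (?z\<^sup>2 + real n * v) * exp (s * X g)) / D\<^sup>2)" for g
      proof -
        have z: "x + X g + real n * m - D = (X g - m) + ?z" by (simp add: algebra_simps)
        show ?thesis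
          unfolding L_def z distrib_left exp_add power2_sum
          using D by (simp add: field_simps)
      qed
      have intL: "integrable M (\<lambda>g. L n (x + X g))"
        unfolding L_eq using int0 int1 int2 by auto
      have "L (Suc n) x = ?c * (\<phi> - (\<phi> * v + 2 * ?z * 0 + (?z\<^sup>2 + real n * v) * \<phi>) / D\<^sup>2)"
        unfolding L_def using D by (simp add: field_simps)
      also have "\<dots> = (\<integral>g. L n (x + X g) \<partial>M)"
        unfolding L_eq using int0 int1 int2 by (simp add: I1 I2 \<phi>_def)
      also have "\<dots> \<le> (\<integral>g. U n (x + X g) \<partial>M)"
      proof (rule integral_mono[OF intL _ Suc])
        show "integrable M (\<lambda>g. U n (x + X g))"
          using U01[of n] by (intro integrable_const_bound[of _ 1]) auto
      qed
      also have "\<dots> \<le> U (Suc n) x" by (rule step)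
      finally show ?case .
    qed
    moreover have "L K (- (m - \<epsilon>) * real K)
      = \<phi> ^ K * exp (- s * (m + \<epsilon>) * real K) * (1 - v / (real K * \<epsilon>\<^sup>2))"
    proof -
      have e: "exp (- 2 * s * D) * exp (s * (- (m - \<epsilon>) * real K)) = exp (- s * (m + \<epsilon>) * real K)"
        by (simp add: exp_add[symmetric] D_def algebra_simps)
      have z: "- (m - \<epsilon>) * real K + real K * m - D = 0" by (simp add: D_def algebra_simps)
      have w: "real K * v / D\<^sup>2 = v / (real K * \<epsilon>\<^sup>2)"
        using K \<epsilon> by (simp add: D_def power2_eq_square)
      have "L K (- (m - \<epsilon>) * real K) = \<phi> ^ K * (exp (- 2 * s * D) * exp (s * (- (m - \<epsilon>) * real K)))
         * (1 - real K * v / D\<^sup>2)"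
        unfolding L_def z by simp
      then show ?thesis unfolding e w .
    qed
    ultimately show ?thesis by metis
  qed
  have "(\<lambda>K. v / (real K * \<epsilon>\<^sup>2)) \<longlonglongrightarrow> 0"
    using \<epsilon> by real_asymp
  then have "\<forall>\<^sub>F K in sequentially. v / (real K * \<epsilon>\<^sup>2) < 1 / 2" by (rule order_tendstoD) simp
  moreover have "\<forall>\<^sub>F K in sequentially. (\<eta> / \<phi>) ^ K < 1 / 2"
    using \<eta> \<phi> by (intro order_tendstoD(2)[OF LIMSEQ_power_zero]) auto
  ultimately show ?thesis
    using eventually_ge_at_top[of 1]
  proof eventually_elim
    case (elim K)
    have "\<eta> ^ K = (\<eta> / \<phi>) ^ K * \<phi> ^ K" using \<phi> by (simp add: power_divide)
    also have "\<dots> \<le> (1 - v / (real K * \<epsilon>\<^sup>2)) * \<phi> ^ K"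
      using elim \<phi> by (intro mult_right_mono) auto
    finally have "\<eta> ^ K * exp (- s * (m + \<epsilon>) * real K)
       \<le> (1 - v / (real K * \<epsilon>\<^sup>2)) * \<phi> ^ K * exp (- s * (m + \<epsilon>) * real K)"
      by (intro mult_right_mono) auto
    also have "\<dots> \<le> U K (- (m - \<epsilon>) * real K)" using main[OF elim(3)] by (simp add: ac_simps)
    finally show ?case .
  qed
qed

text \<open>
  With \<open>y\<close> the threshold per step, the probability of staying above \<open>y ^ K\<close> is at least
  \<open>(\<kappa> / y) ^ K\<close> for every \<open>\<kappa>\<close> below the minimum of the Laplace transform on \<open>[0, 1]\<close>. A positive
  drift of the tilted walk occurs only at \<open>s = 0\<close>, where the threshold can be taken to be 1; a negative
  drift occurs only at \<open>s = 1\<close>, where the factor lost by the threshold is exactly the one gained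
  from the tilt.
\<close>
lemma (in finite_measure) cramer_lower_bound:
  fixes X :: "'a \<Rightarrow> real" and U :: "nat \<Rightarrow> real \<Rightarrow> real"
  assumes X_meas [measurable]: "X \<in> borel_measurable M" and X: "\<And>g. \<bar>X g\<bar> \<le> r"
    and mono: "\<And>K. mono (U K)" and U01: "\<And>K x. U K x \<in> {0..1}"
    and U0: "\<And>x. 0 \<le> x \<Longrightarrow> U 0 x = 1"
    and step: "\<And>K x. (\<integral>g. U K (x + X g) \<partial>M) \<le> U (Suc K) x"
    and \<kappa>: "0 < \<kappa>" "\<And>t. t \<in> {0..1} \<Longrightarrow> \<kappa> < (\<integral>g. exp (t * X g) \<partial>M)"
  obtains K y where "1 \<le> K" "0 < y" "y \<le> 1" "(\<kappa> / y) ^ K \<le> U K (- real K * ln y)"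
proof -
  obtain s where s: "s \<in> {0..1}"
    and s1: "s < 1 \<Longrightarrow> 0 \<le> (\<integral>g. X g * exp (s * X g) \<partial>M)"
    and s0: "0 < s \<Longrightarrow> (\<integral>g. X g * exp (s * X g) \<partial>M) \<le> 0"
    using laplace_minimizer[OF X_meas X] by blast
  define \<phi> where "\<phi> = (\<integral>g. exp (s * X g) \<partial>M)"
  define m where "m = (\<integral>g. X g * exp (s * X g) \<partial>M) / \<phi>"
  have \<phi>: "\<kappa> < \<phi>" "0 < \<phi>" using \<kappa> s unfolding \<phi>_def by (auto intro: less_trans)
  note walk = walk_lower_bound[OF X_meas X mono U01 U0 step s \<phi>_def \<phi>(2) m_def]
  show thesis
  proof (cases "0 < m")
    case True
    then have "\<not> 0 < s" using s0 \<phi> by (auto simp: m_def zero_less_divide_iff)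
    then have "s = 0" using s by simp
    have "\<forall>\<^sub>F K in sequentially. \<kappa> ^ K * exp (- s * (m + m / 2) * real K) \<le> U K (- (m - m / 2) * real K)"
      using True \<kappa> \<phi> by (intro walk) auto
    then obtain K where K: "1 \<le> K" "\<kappa> ^ K \<le> U K (- (m - m / 2) * real K)"
      using eventually_happens'[OF _ eventually_conj[OF eventually_ge_at_top[of 1]]] \<open>s = 0\<close> by fastforce
    have "U K (- (m - m / 2) * real K) \<le> U K 0"
      using True by (intro monoD[OF mono]) auto
    then show thesis using K by (intro that[of K 1]) auto
  next
    case False
    \<comment> \<open>The gap between \<open>\<kappa>\<close> and the minimum \<open>\<phi>\<close> pays for \<open>2 * \<epsilon>\<close>: one \<open>\<epsilon>\<close> for the threshold below the
      drift and one for fluctuations above it. The other half keeps the inequality strict.\<close>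
    define \<epsilon> where "\<epsilon> = ln (\<phi> / \<kappa>) / 4"
    have \<epsilon>: "0 < \<epsilon>" using \<phi> \<kappa> by (simp add: \<epsilon>_def)
    have "\<phi> = \<kappa> * exp (4 * \<epsilon>)" using \<phi> \<kappa> by (simp add: \<epsilon>_def)
    then have \<eta>: "\<kappa> * exp (2 * \<epsilon>) < \<phi>" using \<kappa> \<epsilon> by simp
    define y where "y = exp (m - \<epsilon>)"
    have sm: "s * (m + \<epsilon>) \<le> m + \<epsilon>"
    proof (cases "m = 0")
      case True
      then show ?thesis using s \<epsilon> by (simp add: mult_left_le_one_le)
    next
      case m: False
      have "\<not> s < 1"
      proof
        assume "s < 1"
        then have "0 \<le> m" unfolding m_def using s1 \<phi> by simp
        then show False using False m by simp
      qed
      then have "s = 1" using s by simp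
      then show ?thesis by simp
    qed
    have "\<forall>\<^sub>F K in sequentially. (\<kappa> * exp (2 * \<epsilon>)) ^ K * exp (- s * (m + \<epsilon>) * real K) \<le> U K (- (m - \<epsilon>) * real K)"
      using \<epsilon> \<kappa> \<eta> by (intro walk) auto
    then obtain K where K: "1 \<le> K" "(\<kappa> * exp (2 * \<epsilon>)) ^ K * exp (- s * (m + \<epsilon>) * real K) \<le> U K (- (m - \<epsilon>) * real K)"
      using eventually_happens'[OF _ eventually_conj[OF eventually_ge_at_top[of 1]]] by fastforce
    have "(\<kappa> / y) ^ K = \<kappa> ^ K * exp (real K * (\<epsilon> - m))"
      by (simp add: y_def power_mult_distrib divide_inverse exp_minus[symmetric] exp_of_nat_mult[symmetric])
    also have "\<dots> \<le> \<kappa> ^ K * exp (real K * (2 * \<epsilon> - s * (m + \<epsilon>)))"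
      using \<kappa> sm by (intro mult_left_mono) (auto intro!: mult_left_mono)
    also have "\<dots> = (\<kappa> * exp (2 * \<epsilon>)) ^ K * exp (- s * (m + \<epsilon>) * real K)"
      by (simp add: power_mult_distrib exp_of_nat_mult[symmetric] mult.assoc exp_add[symmetric])
        (simp add: algebra_simps)
    also note K(2)
    also have "- (m - \<epsilon>) * real K = - real K * ln y" by (simp add: y_def algebra_simps)
    finally show thesis using K(1) False \<epsilon> by (intro that[of K y]) (auto simp: y_def)
  qed
qed

section \<open>A supercritical threshold for blocks of matrices\<close>

context positive_matrix_law
begin

lemma integrable_1_plus_min_entry: "integrable (conv (Suc n)) (\<lambda>g. 1 + min_entry g)"
proof -
  have "integrable (conv (Suc n)) min_entry"
    using integrable_min_entry_powr[of 1 n]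
  proof (rule integrable_cong_AE_imp)
    show "min_entry \<in> borel_measurable (conv (Suc n))" by (intro measurable_conv) measurable
    show "AE g in conv (Suc n). min_entry g powr 1 = min_entry g"
      using AE_conv_pos by eventually_elim simp
  qed simp
  then show ?thesis by (intro Bochner_Integration.integrable_add C.integrable_const)
qed

text \<open>
  The integrand dominates \<open>min_entry g powr s\<close> off the window for all \<open>s \<in> [0, 1]\<close> at once, so one
  window serves all exponents.
\<close>
lemma min_entry_tail_vanishes:
  "(\<lambda>R. \<integral>g. (1 + min_entry g) * indicator {g. \<not> (1 / (real R + 1) \<le> min_entry g \<and> min_entry g \<le> real R + 1)} g
      \<partial>conv (Suc n)) \<longlonglongrightarrow> 0"
proof -
  have "(\<lambda>R. \<integral>g. (1 + min_entry g) * indicator {g. \<not> (1 / (real R + 1) \<le> min_entry g \<and> min_entry g \<le> real R + 1)} g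
      \<partial>conv (Suc n)) \<longlonglongrightarrow> (\<integral>g. 0 \<partial>conv (Suc n))"
  proof (rule integral_dominated_convergence[OF _ _ integrable_1_plus_min_entry])
    show "(\<lambda>g. (1 + min_entry g) * indicator {g. \<not> (1 / (real R + 1) \<le> min_entry g \<and> min_entry g \<le> real R + 1)} g)
        \<in> borel_measurable (conv (Suc n))" for R
      by (intro measurable_conv) measurable
    show "AE g in conv (Suc n). (\<lambda>R. (1 + min_entry g) *
        indicator {g. \<not> (1 / (real R + 1) \<le> min_entry g \<and> min_entry g \<le> real R + 1)} g) \<longlonglongrightarrow> (0::real)"
    proof (rule AE_mp[OF AE_conv_pos], rule AE_I2, rule impI)
      fix g :: "real^'n^'n" assume g: "0 < min_entry g"
      have "(\<lambda>R. 1 / (real R + 1)) \<longlonglongrightarrow> 0" by real_asymp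
      then have "\<forall>\<^sub>F R in sequentially. 1 / (real R + 1) < min_entry g"
        using g by (rule order_tendstoD)
      moreover have "\<forall>\<^sub>F R in sequentially. min_entry g \<le> real R + 1" by real_asymp
      ultimately have "\<forall>\<^sub>F R in sequentially. (1 + min_entry g) *
          indicator {g. \<not> (1 / (real R + 1) \<le> min_entry g \<and> min_entry g \<le> real R + 1)} g = (0::real)"
        by eventually_elim auto
      then show "(\<lambda>R. (1 + min_entry g) *
          indicator {g. \<not> (1 / (real R + 1) \<le> min_entry g \<and> min_entry g \<le> real R + 1)} g) \<longlonglongrightarrow> (0::real)"
        by (rule tendsto_eventually)
    qed
    show "AE g in conv (Suc n). norm ((1 + min_entry g) *
        indicator {g. \<not> (1 / (real R + 1) \<le> min_entry g \<and> min_entry g \<le> real R + 1)} g) \<le> 1 + min_entry g" for R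
      using AE_conv_pos by eventually_elim (auto simp: indicator_def)
  qed simp
  then show ?thesis by simp
qed

text \<open>
  Two scales are involved. Blocks of length \<open>N\<close> are long enough for the constant in
  \<open>min_entry_moment_ge\<close> to be absorbed by \<open>(\<lambda> * m) ^ N\<close>; the logarithms of their least entries, cut off to a bounded
  window, are the steps of a random walk. The large deviation bound for \<open>K\<close> such steps then gives the
  final length \<open>L = N * K\<close>.
\<close>
lemma supercritical_block_exists:
  assumes lam: "0 < lam" "\<And>s. s \<in> {0..1} \<Longrightarrow> lam \<le> k_rate \<mu> s" and m: "1 < lam * m"
  obtains L \<tau> where "1 \<le> L" "0 < \<tau>" "\<tau> \<le> 1"
    "1 < measure (conv L) {g \<in> GL. \<tau> \<le> min_entry g} * \<tau> * m ^ L"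
proof -
  have m0: "0 < m" using m lam(1) zero_less_mult_pos[of lam m] by linarith
  define c where "c = (\<integral>g. min 1 (min_entry g) \<partial>\<mu>)"
  have c: "0 < c" unfolding c_def by (rule min_entry_mean_pos)
  obtain n where "1 / (c\<^sup>2 * m\<^sup>2) < (lam * m) ^ n" using real_arch_pow[OF m] by blast
  also have "\<dots> \<le> (lam * m) ^ Suc n" using m by (intro power_increasing) auto
  finally obtain n where n: "1 \<le> n" "1 / (c\<^sup>2 * m\<^sup>2) < (lam * m) ^ n" by fastforce
  define N where "N = n + 2"
  define \<kappa>' where "\<kappa>' = c\<^sup>2 * lam ^ n"
  define \<kappa> where "\<kappa> = (\<kappa>' + 1 / m ^ N) / 2"
  have \<kappa>'m: "1 / m ^ N < \<kappa>'"
  proof -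
    have "1 < (lam * m) ^ n * (c\<^sup>2 * m\<^sup>2)" using n c m0 by (simp add: field_simps)
    also have "\<dots> = \<kappa>' * m ^ N" by (simp add: \<kappa>'_def N_def power_add power_mult_distrib power2_eq_square)
    finally show ?thesis using m0 by (simp add: field_simps)
  qed
  have \<kappa>: "\<kappa> < \<kappa>'" "1 / m ^ N < \<kappa>" "0 < \<kappa>"
    using \<kappa>'m m0 by (auto simp: \<kappa>_def intro!: add_pos_pos less_trans[OF _ \<kappa>'m])
  have \<kappa>_moment: "\<kappa>' \<le> (\<integral>g. min_entry g powr s \<partial>conv N)" if s: "s \<in> {0..1}" for s
  proof -
    have "\<kappa>' \<le> c\<^sup>2 * k_rate \<mu> s ^ n"
      unfolding \<kappa>'_def using lam s by (intro mult_left_mono power_mono) auto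
    also have "\<dots> \<le> (\<integral>g. min_entry g powr s \<partial>conv N)"
      unfolding c_def N_def using s n by (intro min_entry_moment_ge) auto
    finally show ?thesis .
  qed
  have NS: "N = Suc (n + 1)" by (simp add: N_def)
  define T where "T R = {g :: real^'n^'n. \<not> (1 / (real R + 1) \<le> min_entry g \<and> min_entry g \<le> real R + 1)}" for R
  have "\<forall>\<^sub>F R in sequentially. (\<integral>g. (1 + min_entry g) * indicator (T R) g \<partial>conv N) < \<kappa>' - \<kappa>"
    unfolding NS T_def using \<kappa> by (intro order_tendstoD(2)[OF min_entry_tail_vanishes]) auto
  then obtain R where R: "(\<integral>g. (1 + min_entry g) * indicator (T R) g \<partial>conv N) < \<kappa>' - \<kappa>"
    using eventually_happens' by fastforce
  define W where "W = {g :: real^'n^'n. 1 / (real R + 1) \<le> min_entry g \<and> min_entry g \<le> real R + 1}"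
  have TW: "T R = - W" by (auto simp: T_def W_def)
  have W_borel: "W \<in> sets borel"
  proof -
    have "{x \<in> space borel. 1 / (real R + 1) \<le> min_entry (x :: real^'n^'n) \<and> min_entry x \<le> real R + 1} \<in> sets borel"
      by measurable
    then show ?thesis by (simp add: W_def)
  qed
  have W_pos: "0 < min_entry g" if "g \<in> W" for g
  proof -
    have "0 < 1 / (real R + 1)" by simp
    then show ?thesis using that unfolding W_def by (auto intro: less_le_trans[of 0 "1 / (real R + 1)"])
  qed
  \<comment> \<open>The value 0 outside the window only makes \<open>X\<close> bounded everywhere; the step distribution \<open>\<rho>\<close> below
    is the restriction to \<open>W\<close>, a measure of mass possibly less than 1.\<close>
  define X where "X g = (if g \<in> W then ln (min_entry g) else 0)" for g
  have X_borel: "X \<in> borel_measurable borel"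
    unfolding X_def[abs_def] using W_borel by measurable
  have X_bound: "\<bar>X g\<bar> \<le> ln (real R + 1)" for g
  proof (cases "g \<in> W")
    case True
    then have "ln (1 / (real R + 1)) \<le> ln (min_entry g)" "ln (min_entry g) \<le> ln (real R + 1)"
      using W_pos[OF True] by (auto simp: W_def)
    then show ?thesis using True by (simp add: X_def ln_div)
  qed (simp add: X_def)
  have X_exp: "exp (t * X g) = min_entry g powr t" if "g \<in> W" for g t
    using that W_pos[OF that] by (simp add: X_def powr_def)
  define \<rho> where "\<rho> = restrict_space (conv N) W"
  have W_conv: "W \<inter> space (conv N) \<in> sets (conv N)"
    using sets_GL_borelI[OF W_borel] by simp
  interpret R: finite_measure \<rho>
    unfolding \<rho>_def
    by (rule finite_measureI) (simp add: space_restrict_space emeasure_restrict_space W_conv[simplified])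
  have X_\<rho>: "X \<in> borel_measurable \<rho>"
    unfolding \<rho>_def by (intro measurable_restrict_space1 measurable_conv X_borel)
  have int_\<rho>: "(\<integral>g. f g \<partial>\<rho>) = (\<integral>g. indicator W g * f g \<partial>conv N)" for f :: "_ \<Rightarrow> real"
    unfolding \<rho>_def using integral_restrict_space[OF W_conv, of f] by simp
  define S where "S x = {g \<in> GL. exp (- x) \<le> min_entry (g :: real^'n^'n)}" for x
  have S_sets: "S x \<in> sets (conv k)" for x k
    unfolding S_def using sets_min_entry_ge by simp
  \<comment> \<open>The case \<open>K = 0\<close> is separate because the empty product is the identity matrix, whose least entry
    is 0 rather than 1 in dimension above one.\<close>
  define U where "U K x = (if K = 0 then (if 0 \<le> x then 1 else 0) else measure (conv (N * K)) (S x))" for K x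
  have "mono (U K)" for K
  proof (rule monoI)
    fix x y :: real assume "x \<le> y"
    then have "S x \<subseteq> S y" unfolding S_def by (auto elim: order_trans[rotated])
    then show "U K x \<le> U K y"
      using \<open>x \<le> y\<close> S_sets by (auto simp: U_def intro!: C.finite_measure_mono)
  qed
  note mono = this
  have U01: "U K x \<in> {0..1}" for K x by (auto simp: U_def)
  have step: "(\<integral>g. U K (x + X g) \<partial>\<rho>) \<le> U (Suc K) x" for K x
  proof -
    have U_meas [measurable]: "U K \<in> borel_measurable borel" by (rule borel_measurable_mono[OF mono])
    have UX: "(\<lambda>g. U K (x + X g)) \<in> borel_measurable borel" using X_borel by measurable
    have int: "integrable (conv N) (\<lambda>g. indicator W g * U K (x + X g))"
    proof (rule C.integrable_const_bound[where B = 1])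
      show "AE g in conv N. norm (indicator W g * U K (x + X g)) \<le> 1"
        using U01[of K] by (auto simp: indicator_def)
      show "(\<lambda>g. indicator W g * U K (x + X g)) \<in> borel_measurable (conv N)"
        by (rule measurable_conv[OF borel_measurable_times[OF borel_measurable_indicator[OF W_borel] UX]])
    qed
    have inner: "indicator W g * ennreal (U K (x + X g)) \<le> (\<integral>\<^sup>+h. indicator (S x) (g ** h) \<partial>conv (N * K))"
      if g: "g \<in> GL" for g
    proof (cases "g \<in> W")
      case False
      then show ?thesis by simp
    next
      case W: True
      have eX: "exp (X g) = min_entry g" using X_exp[OF W, of 1] W_pos[OF W] by simp
      show ?thesis
      proof (cases "K = 0")
        case True
        have "g \<in> S x" if "0 \<le> x + X g"
        proof -
          have "exp (- x) \<le> exp (X g)" using that by simp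
          then show ?thesis using g eX by (simp add: S_def)
        qed
        moreover have "(\<integral>\<^sup>+h. indicator (S x) (g ** h) \<partial>conv (N * K)) = indicator (S x) g"
        proof -
          have "(\<lambda>h. g ** h) \<in> measurable GL_borel GL_borel"
            using g by (intro measurable_GL_mult measurable_const) (auto simp: space_GL_borel)
          then have "(\<lambda>h. indicator (S x) (g ** h) :: ennreal) \<in> borel_measurable GL_borel"
            by (rule measurable_compose[OF _ borel_measurable_indicator]) (use S_sets[of x 0] in simp)
          then show ?thesis
            using True by (simp add: nn_integral_return space_GL_borel mat_1_in_GL)
        qed
        ultimately show ?thesis using True W by (auto simp: U_def)
      next
        case False
        have "indicator W g * ennreal (U K (x + X g)) = emeasure (conv (N * K)) (S (x + X g))"
          using W False by (simp add: U_def C.emeasure_eq_measure)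
        also have "\<dots> = (\<integral>\<^sup>+h. indicator (S (x + X g)) h \<partial>conv (N * K))"
          using S_sets by simp
        also have "\<dots> \<le> (\<integral>\<^sup>+h. indicator (S x) (g ** h) \<partial>conv (N * K))"
        proof (intro nn_integral_mono)
          fix h :: "real^'n^'n"
          have "g ** h \<in> S x" if h: "h \<in> S (x + X g)"
          proof -
            have h': "exp (- (x + X g)) \<le> min_entry h" "h \<in> GL" using h by (auto simp: S_def)
            have "exp (- x) = exp (X g) * exp (- (x + X g))" by (simp add: exp_add[symmetric])
            also have "\<dots> \<le> min_entry g * min_entry h"
              unfolding eX using h' W_pos[OF W] by (intro mult_left_mono) auto
            also have "\<dots> \<le> min_entry (g ** h)"
              using W_pos[OF W] h' order_trans[OF exp_ge_zero h'(1)] by (intro min_entry_mult) auto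
            finally show ?thesis using g h' by (simp add: S_def GL_mult)
          qed
          then show "indicator (S (x + X g)) h \<le> (indicator (S x) (g ** h) :: ennreal)"
            by (auto simp: indicator_def)
        qed
        finally show ?thesis .
      qed
    qed
    have "ennreal (\<integral>g. U K (x + X g) \<partial>\<rho>) = (\<integral>\<^sup>+g. ennreal (indicator W g * U K (x + X g)) \<partial>conv N)"
      unfolding int_\<rho> using U01[of K]
      by (intro nn_integral_eq_integral[symmetric] int) auto
    also have "\<dots> = (\<integral>\<^sup>+g. indicator W g * ennreal (U K (x + X g)) \<partial>conv N)"
      by (intro nn_integral_cong) (auto simp: indicator_def)
    also have "\<dots> \<le> (\<integral>\<^sup>+g. \<integral>\<^sup>+h. indicator (S x) (g ** h) \<partial>conv (N * K) \<partial>conv N)"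
      by (intro nn_integral_mono inner) simp
    also have "\<dots> = (\<integral>\<^sup>+g. indicator (S x) g \<partial>conv (N + N * K))"
      using S_sets[of x 0] by (intro nn_integral_conv_add[symmetric] borel_measurable_indicator) simp
    also have "\<dots> = emeasure (conv (N * Suc K)) (S x)"
      using S_sets by simp
    also have "\<dots> = ennreal (U (Suc K) x)"
      by (simp add: U_def C.emeasure_eq_measure del: convolution_power.simps)
    finally show ?thesis using U01[of "Suc K" x] by (subst (asm) ennreal_le_iff) auto
  qed
  have big: "\<kappa> < (\<integral>g. exp (t * X g) \<partial>\<rho>)" if t: "t \<in> {0..1}" for t
  proof -
    have posN: "AE g in conv N. 0 < min_entry g" unfolding NS by (rule AE_conv_pos)
    have W: "W \<inter> space (conv N) \<in> sets (conv N)" by (rule W_conv)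
    have int_t: "integrable (conv N) (\<lambda>g. min_entry g powr t)"
      unfolding NS using t by (intro integrable_min_entry_powr) auto
    have int_1: "integrable (conv N) (\<lambda>g. 1 + min_entry g)"
      unfolding NS by (rule integrable_1_plus_min_entry)
    have iW: "integrable (conv N) (\<lambda>g. indicator W g * min_entry g powr t)"
    proof (rule Bochner_Integration.integrable_bound[OF int_t])
      show "(\<lambda>g. indicator W g * min_entry g powr t) \<in> borel_measurable (conv N)"
        by (rule measurable_conv[OF borel_measurable_times[OF borel_measurable_indicator[OF W_borel]]]) measurable
    qed (auto simp: indicator_def)
    have iT: "integrable (conv N) (\<lambda>g. (1 + min_entry g) * indicator (T R) g)"
    proof (rule Bochner_Integration.integrable_bound[OF int_1])
      have T: "T R \<in> sets borel" unfolding TW using W_borel by auto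
      show "(\<lambda>g. (1 + min_entry g) * indicator (T R) g) \<in> borel_measurable (conv N)"
        by (rule measurable_conv[OF borel_measurable_times[OF _ borel_measurable_indicator[OF T]]]) measurable
    qed (auto simp: indicator_def)
    have "\<kappa>' \<le> (\<integral>g. min_entry g powr t \<partial>conv N)" by (rule \<kappa>_moment[OF t])
    also have "\<dots> \<le> (\<integral>g. indicator W g * min_entry g powr t + (1 + min_entry g) * indicator (T R) g \<partial>conv N)"
    proof (rule integral_mono_AE[OF int_t Bochner_Integration.integrable_add[OF iW iT]],
        rule AE_mp[OF posN], rule AE_I2, rule impI)
      fix g :: "real^'n^'n" assume g: "0 < min_entry g"
      have "min_entry g powr t \<le> 1 + min_entry g"
      proof (cases "min_entry g \<le> 1")
        case True
        then have "min_entry g powr t \<le> 1" using g t by (intro powr_le1) auto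
        then show ?thesis using g by simp
      next
        case False
        then have "min_entry g powr t \<le> min_entry g powr 1" using t by (intro powr_mono) auto
        then show ?thesis using g by simp
      qed
      then show "min_entry g powr t \<le> indicator W g * min_entry g powr t + (1 + min_entry g) * indicator (T R) g"
        by (auto simp: TW indicator_def)
    qed
    also have "\<dots> = (\<integral>g. indicator W g * min_entry g powr t \<partial>conv N) + (\<integral>g. (1 + min_entry g) * indicator (T R) g \<partial>conv N)"
      by (rule Bochner_Integration.integral_add[OF iW iT])
    also have "(\<integral>g. indicator W g * min_entry g powr t \<partial>conv N) = (\<integral>g. exp (t * X g) \<partial>\<rho>)"
      unfolding int_\<rho> by (intro Bochner_Integration.integral_cong) (auto simp: indicator_def X_exp)
    finally show ?thesis using R by linarith
  qed
  obtain K y where K: "1 \<le> K" "0 < y" "y \<le> 1" "(\<kappa> / y) ^ K \<le> U K (- real K * ln y)"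
    by (rule R.cramer_lower_bound[where X = X and U = U, OF X_\<rho> X_bound mono U01 _ step \<kappa>(3) big]) (auto simp: U_def)
  show thesis
  proof (rule that[of "N * K" "y ^ K"])
    show "1 \<le> N * K" using K by (simp add: N_def)
    show "0 < y ^ K" "y ^ K \<le> 1" using K by (auto intro: power_le_one)
    have "exp (- (- real K * ln y)) = y ^ K" using K by (simp add: exp_of_nat_mult)
    then have U_eq: "U K (- real K * ln y) = measure (conv (N * K)) {g \<in> GL. y ^ K \<le> min_entry g}"
      using K by (simp add: U_def S_def)
    have "1 < \<kappa> * m ^ N" using \<kappa>(2) m0 by (simp add: field_simps)
    then have "1 < (\<kappa> * m ^ N) ^ K" using K by (intro one_less_power) auto
    also have "\<dots> = (\<kappa> / y) ^ K * y ^ K * m ^ (N * K)"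
      using K by (simp add: power_mult_distrib power_mult power_divide)
    also have "\<dots> \<le> U K (- real K * ln y) * y ^ K * m ^ (N * K)"
      using K m0 by (intro mult_right_mono) auto
    finally show "1 < measure (conv (N * K)) {g \<in> GL. y ^ K \<le> min_entry g} * y ^ K * m ^ (N * K)"
      unfolding U_eq .
  qed
qed

end

section \<open>Cuts and flows on the tree\<close>

definition descendants :: "(nat list \<Rightarrow> nat) \<Rightarrow> nat \<Rightarrow> nat list \<Rightarrow> nat list set" where
  "descendants B k v = {w. length w = length v + k \<and> take (length v) w = v \<and>
     (\<forall>l. length v \<le> l \<and> l < length w \<longrightarrow> w ! l \<in> {1..B (take l w)})}"

lemma tree_level_eq_descendants: "tree_level B n = descendants B n []"
  by (auto simp: tree_level_def descendants_def)

lemma descendants_0: "descendants B 0 v = {v}"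
  by (auto simp: descendants_def)

lemma take_Suc_eq_append_iff:
  "Suc n \<le> length w \<Longrightarrow> length v = n \<Longrightarrow> take (Suc n) w = v @ [i] \<longleftrightarrow> take n w = v \<and> w ! n = i"
  by (auto simp: take_Suc_conv_app_nth)

lemma descendants_Suc: "descendants B (Suc k) v = (\<Union>i\<in>{1..B v}. descendants B k (v @ [i]))"
proof (intro set_eqI iffI)
  fix w assume w: "w \<in> descendants B (Suc k) v"
  then have "w ! length v \<in> {1..B v}" by (auto simp: descendants_def)
  moreover have "w \<in> descendants B k (v @ [w ! length v])"
    using w by (auto simp: descendants_def take_Suc_eq_append_iff)
  ultimately show "w \<in> (\<Union>i\<in>{1..B v}. descendants B k (v @ [i]))" by blast
next
  fix w assume "w \<in> (\<Union>i\<in>{1..B v}. descendants B k (v @ [i]))"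
  then obtain i where i: "i \<in> {1..B v}" "w \<in> descendants B k (v @ [i])" by blast
  then have v: "take (length v) w = v" "w ! length v = i" "length w = length v + Suc k"
    by (auto simp: descendants_def take_Suc_eq_append_iff)
  show "w \<in> descendants B (Suc k) v"
    unfolding descendants_def
  proof (intro CollectI conjI allI impI)
    fix l assume "length v \<le> l \<and> l < length w"
    then show "w ! l \<in> {1..B (take l w)}"
      using i v by (cases "l = length v") (auto simp: descendants_def)
  qed (use v in auto)
qed

lemma finite_descendants [simp]: "finite (descendants B k v)"
proof (induction k arbitrary: v)
  case (Suc k)
  then show ?case unfolding descendants_Suc by (intro finite_UN_I) auto
qed (simp add: descendants_0)

lemma descendants_child: "w \<in> descendants B k (v @ [i]) \<Longrightarrow> w ! length v = i \<and> take (length v) w = v"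
  by (auto simp: descendants_def take_Suc_eq_append_iff)

lemma sum_descendants_Suc:
  fixes f :: "nat list \<Rightarrow> 'a::comm_monoid_add"
  shows "(\<Sum>w\<in>descendants B (Suc k) v. f w) = (\<Sum>i\<in>{1..B v}. \<Sum>w\<in>descendants B k (v @ [i]). f w)"
  unfolding descendants_Suc
proof (rule sum.UNION_disjoint)
  show "\<forall>i\<in>{1..B v}. \<forall>j\<in>{1..B v}. i \<noteq> j \<longrightarrow> descendants B k (v @ [i]) \<inter> descendants B k (v @ [j]) = {}"
    using descendants_child by blast
qed auto

text \<open>
  The least weight of a cut separating \<open>v\<close> from its descendants \<open>k\<close> generations later, where a vertex
  \<open>u\<close> has weight \<open>m ^ (- \<bar>u\<bar>)\<close>: either \<open>v\<close> itself is cut, or optimal cuts of the subtrees of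
  its children are combined.
\<close>
primrec min_cut :: "(nat list \<Rightarrow> nat) \<Rightarrow> real \<Rightarrow> nat \<Rightarrow> nat list \<Rightarrow> real" where
  "min_cut B m 0 v = (1 / m) ^ length v"
| "min_cut B m (Suc k) v = min ((1 / m) ^ length v) (\<Sum>i\<in>{1..B v}. min_cut B m k (v @ [i]))"

lemma min_cut_nonneg: "0 < m \<Longrightarrow> 0 \<le> min_cut B m k v"
  by (induction k arbitrary: v) (auto intro!: sum_nonneg)

text \<open>
  Max-flow min-cut for trees. The flow is recorded by its values on the last generation; the flow
  through \<open>u\<close> is the sum over the descendants of \<open>u\<close>. It is built from the top by splitting
  the mass \<open>t\<close> among the children in proportion to their minimal cuts, which respects their capacities.
\<close>
lemma flow_below_min_cut:
  assumes m: "0 < m" and t: "0 \<le> t" "t \<le> min_cut B m k v"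
  obtains f :: "nat list \<Rightarrow> real" where "\<And>w. 0 \<le> f w" "(\<Sum>w\<in>descendants B k v. f w) = t"
    "\<And>u. length v \<le> length u \<Longrightarrow>
      (\<Sum>w\<in>{w \<in> descendants B k v. take (length u) w = u}. f w) \<le> (1 / m) ^ length u"
proof -
  have "\<exists>f :: nat list \<Rightarrow> real. (\<forall>w. 0 \<le> f w) \<and> (\<Sum>w\<in>descendants B k v. f w) = t \<and>
    (\<forall>u. length v \<le> length u \<longrightarrow>
      (\<Sum>w\<in>{w \<in> descendants B k v. take (length u) w = u}. f w) \<le> (1 / m) ^ length u)"
    using t
  proof (induction k arbitrary: v t)
    case 0
    have "(\<Sum>w\<in>{w \<in> {v}. take (length u) w = u}. t) \<le> (1 / m) ^ length u" if u: "length v \<le> length u" for u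
    proof (cases "u = v")
      case True
      then have "{w \<in> {v}. take (length u) w = u} = {v}" by auto
      then show ?thesis using True 0 by simp
    next
      case False
      then have "{w \<in> {v}. take (length u) w = u} = {}" using u by auto
      then show ?thesis using m by (simp only: sum.empty) simp
    qed
    then show ?case using 0 by (intro exI[of _ "\<lambda>_. t"]) (simp add: descendants_0)
  next
    case (Suc k)
    define S where "S = (\<Sum>i\<in>{1..B v}. min_cut B m k (v @ [i]))"
    \<comment> \<open>If \<open>S = 0\<close> then \<open>t = 0\<close>, and division by zero gives the correct shares 0.\<close>
    define q where "q i = t * min_cut B m k (v @ [i]) / S" for i
    have tS: "t \<le> S" "t \<le> (1 / m) ^ length v" using Suc.prems by (auto simp: S_def)
    have q: "0 \<le> q i" "q i \<le> min_cut B m k (v @ [i])" for i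
    proof -
      have S0: "0 \<le> S" using tS Suc.prems by simp
      then show "0 \<le> q i"
        unfolding q_def using min_cut_nonneg[OF m, of B k "v @ [i]"] Suc.prems by simp
      show "q i \<le> min_cut B m k (v @ [i])"
      proof (cases "S = 0")
        case False
        have "t * min_cut B m k (v @ [i]) \<le> S * min_cut B m k (v @ [i])"
          using tS min_cut_nonneg[OF m] by (intro mult_right_mono)
        then show ?thesis using False S0 by (simp add: q_def field_simps)
      qed (simp add: q_def min_cut_nonneg[OF m])
    qed
    have sum_q: "(\<Sum>i\<in>{1..B v}. q i) = t"
    proof -
      have "(\<Sum>i\<in>{1..B v}. q i) = t * S / S"
        by (simp add: q_def S_def sum_divide_distrib[symmetric] sum_distrib_left[symmetric])
      then show ?thesis using tS Suc.prems by auto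
    qed
    have "\<forall>i. \<exists>f :: nat list \<Rightarrow> real. (\<forall>w. 0 \<le> f w) \<and> (\<Sum>w\<in>descendants B k (v @ [i]). f w) = q i \<and>
      (\<forall>u. length (v @ [i]) \<le> length u \<longrightarrow>
        (\<Sum>w\<in>{w \<in> descendants B k (v @ [i]). take (length u) w = u}. f w) \<le> (1 / m) ^ length u)"
      using Suc.IH q by blast
    from choice[OF this] obtain F :: "nat \<Rightarrow> nat list \<Rightarrow> real" where F: "\<And>i w. 0 \<le> F i w"
      "\<And>i. (\<Sum>w\<in>descendants B k (v @ [i]). F i w) = q i"
      "\<And>i u. length (v @ [i]) \<le> length u \<Longrightarrow>
        (\<Sum>w\<in>{w \<in> descendants B k (v @ [i]). take (length u) w = u}. F i w) \<le> (1 / m) ^ length u"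
      by blast
    define f where "f w = F (w ! length v) w" for w
    have f_child: "(\<Sum>w\<in>A. f w) = (\<Sum>w\<in>A. F i w)" if "A \<subseteq> descendants B k (v @ [i])" for A i
      using that by (intro sum.cong) (auto simp: f_def dest!: subsetD descendants_child)
    have total: "(\<Sum>w\<in>descendants B (Suc k) v. f w) = t"
    proof -
      have "(\<Sum>w\<in>descendants B k (v @ [i]). f w) = q i" for i
        using f_child[of "descendants B k (v @ [i])" i] F(2)[of i] by simp
      then show ?thesis unfolding sum_descendants_Suc using sum_q by simp
    qed
    have "(\<Sum>w\<in>{w \<in> descendants B (Suc k) v. take (length u) w = u}. f w) \<le> (1 / m) ^ length u"
      if u: "length v \<le> length u" for u
    proof (cases "length u = length v")
      case True
      have "(\<Sum>w\<in>{w \<in> descendants B (Suc k) v. take (length u) w = u}. f w) \<le> t"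
        unfolding total[symmetric] using F(1) by (intro sum_mono2) (auto simp: f_def)
      then show ?thesis using tS True by simp
    next
      case False
      then have u': "Suc (length v) \<le> length u" using u by simp
      define i where "i = u ! length v"
      have sub: "{w \<in> descendants B (Suc k) v. take (length u) w = u}
          \<subseteq> {w \<in> descendants B k (v @ [i]). take (length u) w = u}"
      proof safe
        fix w assume w: "w \<in> descendants B (Suc k) v" "take (length u) w = u"
        then obtain j where j: "w \<in> descendants B k (v @ [j])" by (auto simp: descendants_Suc)
        then have "j = w ! length v" using descendants_child by blast
        also have "\<dots> = take (length u) w ! length v" using u' by simp
        also have "\<dots> = i" using w by (simp add: i_def)
        finally show "w \<in> descendants B k (v @ [i])" using j by simp
      qed
      have "(\<Sum>w\<in>{w \<in> descendants B (Suc k) v. take (length u) w = u}. f w)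
          \<le> (\<Sum>w\<in>{w \<in> descendants B k (v @ [i]). take (length u) w = u}. f w)"
        using F(1) by (intro sum_mono2 sub) (auto simp: f_def)
      also have "\<dots> = (\<Sum>w\<in>{w \<in> descendants B k (v @ [i]). take (length u) w = u}. F i w)"
        by (intro f_child) auto
      also have "\<dots> \<le> (1 / m) ^ length u" using u' by (intro F(3)) simp
      finally show ?thesis .
    qed
    then show ?case using F(1) total by (intro exI[of _ f]) (simp add: f_def)
  qed
  then show thesis using that by blast
qed

text \<open>
  A list rather than a set of vertices: the sums of the sublists then simply add up, and
  the cylinders over its entries can be enumerated in the countable covers of Hausdorff measure.
\<close>
lemma min_cut_attained:
  assumes m: "0 < m"
  shows "\<exists>cs. (\<Sum>u\<leftarrow>cs. (1 / m) ^ length u) \<le> min_cut B m k v \<and>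
    (\<forall>w\<in>descendants B k v. \<exists>u\<in>set cs. take (length u) w = u)"
proof (induction k arbitrary: v)
  case 0
  show ?case by (rule exI[of _ "[v]"]) (simp add: descendants_0)
next
  case (Suc k)
  show ?case
  proof (cases "(1 / m) ^ length v \<le> (\<Sum>i\<in>{1..B v}. min_cut B m k (v @ [i]))")
    case True
    then show ?thesis by (intro exI[of _ "[v]"]) (auto simp: descendants_def)
  next
    case False
    have "\<forall>i. \<exists>cs. (\<Sum>u\<leftarrow>cs. (1 / m) ^ length u) \<le> min_cut B m k (v @ [i]) \<and>
      (\<forall>w\<in>descendants B k (v @ [i]). \<exists>u\<in>set cs. take (length u) w = u)"
      using Suc by blast
    from choice[OF this] obtain P where P: "\<And>i. (\<Sum>u\<leftarrow>P i. (1 / m) ^ length u) \<le> min_cut B m k (v @ [i])"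
      "\<And>i w. w \<in> descendants B k (v @ [i]) \<Longrightarrow> \<exists>u\<in>set (P i). take (length u) w = u"
      by blast
    let ?cs = "concat (map P [1..<Suc (B v)])"
    have concat_sum: "(\<Sum>u\<leftarrow>concat xss. (1 / m) ^ length u) = (\<Sum>xs\<leftarrow>xss. \<Sum>u\<leftarrow>xs. (1 / m) ^ length u)"
      for xss :: "nat list list list"
      by (induction xss) auto
    have "(\<Sum>u\<leftarrow>?cs. (1 / m) ^ length u) = (\<Sum>i\<leftarrow>[1..<Suc (B v)]. \<Sum>u\<leftarrow>P i. (1 / m) ^ length u)"
      unfolding concat_sum by (simp add: comp_def del: upt_Suc)
    also have "\<dots> = (\<Sum>i\<in>{1..B v}. \<Sum>u\<leftarrow>P i. (1 / m) ^ length u)"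
      unfolding sum_set_upt_conv_sum_list_nat[symmetric] by (rule sum.cong) auto
    also have "\<dots> \<le> (\<Sum>i\<in>{1..B v}. min_cut B m k (v @ [i]))"
      by (intro sum_mono P)
    finally have "(\<Sum>u\<leftarrow>?cs. (1 / m) ^ length u) \<le> min_cut B m (Suc k) v"
      using False by simp
    moreover have "\<forall>w\<in>descendants B (Suc k) v. \<exists>u\<in>set ?cs. take (length u) w = u"
    proof
      fix w assume "w \<in> descendants B (Suc k) v"
      then obtain i where i: "i \<in> {1..B v}" "w \<in> descendants B k (v @ [i])"
        by (auto simp: descendants_Suc)
      then obtain u where "u \<in> set (P i)" "take (length u) w = u" using P(2) by blast
      then show "\<exists>u\<in>set ?cs. take (length u) w = u"
        using i by (intro bexI[of _ u]) (auto simp del: upt_Suc)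
    qed
    ultimately show ?thesis by blast
  qed
qed

lemma set_diam_cylinder:
  "set_diam boundary_dist {x \<in> A. map x [0..<n] = u} \<le> ennreal (exp (- real n))"
  unfolding set_diam_def
proof (rule SUP_least)
  fix p assume "p \<in> {x \<in> A. map x [0..<n] = u} \<times> {x \<in> A. map x [0..<n] = u}"
  then obtain x y where p: "p = (x, y)" and xy: "map x [0..<n] = map y [0..<n]" by auto
  have "boundary_dist x y \<le> exp (- real n)"
  proof (cases "x = y")
    case False
    then have "\<exists>k. x k \<noteq> y k" by auto
    then have "x (common_prefix_length x y) \<noteq> y (common_prefix_length x y)"
      unfolding common_prefix_length_def by (rule LeastI_ex)
    moreover have "x k = y k" if "k < n" for k
      using xy that by (auto simp: map_eq_conv)
    ultimately have "n \<le> common_prefix_length x y" by (meson not_le)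
    then show ?thesis using False by (simp add: boundary_dist_def)
  qed (simp add: boundary_dist_def)
  then show "(case p of (x, y) \<Rightarrow> ennreal (boundary_dist x y)) \<le> ennreal (exp (- real n))"
    unfolding p by (simp add: ennreal_leI)
qed

text \<open>
  A cut \<open>cs\<close> yields a cover of the boundary by the cylinders over its vertices. A cylinder over \<open>u\<close> has
  diameter at most \<open>exp (- \<bar>u\<bar>)\<close>, whose power \<open>ln m\<close> is the weight \<open>m ^ (- \<bar>u\<bar>)\<close>. Since \<open>ln m\<close> is below the
  Hausdorff dimension, covers by small sets cannot have arbitrarily small weight; and a cut of small
  weight consists of vertices far from the root, so its cylinders are small.
\<close>
lemma min_cut_bounded_below:
  assumes m: "1 < m" "m < branching_rate B"
  obtains c where "0 < c" "\<And>n. c \<le> min_cut B m n []"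
proof -
  let ?S = "tree_boundary B"
  define \<alpha> where "\<alpha> = ln m"
  have \<alpha>: "0 < \<alpha>" using m by (simp add: \<alpha>_def)
  have dim: "\<alpha> < enn2real (hausdorff_dim ?S boundary_dist)"
    using m ln_less_cancel_iff[of m "branching_rate B"] by (simp add: branching_rate_def \<alpha>_def)
  have "hausdorff_measure ?S boundary_dist \<alpha> \<noteq> 0"
  proof
    assume "hausdorff_measure ?S boundary_dist \<alpha> = 0"
    then have "hausdorff_dim ?S boundary_dist \<le> ennreal \<alpha>"
      unfolding hausdorff_dim_def using \<alpha> by (intro Inf_lower) auto
    then have "enn2real (hausdorff_dim ?S boundary_dist) \<le> \<alpha>"
      using \<alpha> by (intro enn2real_leI) auto
    then show False using dim by simp
  qed
  then obtain \<epsilon> where \<epsilon>: "0 < \<epsilon>" "hausdorff_premeasure ?S boundary_dist \<alpha> \<epsilon> \<noteq> 0"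
    unfolding hausdorff_measure_def by (metis (no_types, lifting) SUP_least bot.extremum_uniqueI bot_ennreal greaterThan_iff le_zero_eq)
  define P where "P = hausdorff_premeasure ?S boundary_dist \<alpha> \<epsilon>"
  \<comment> \<open>The first term makes every cylinder of a cut lighter than \<open>c\<close> have diameter at most \<open>\<epsilon>\<close>; the
    truncation at 1 covers an infinite premeasure.\<close>
  define c where "c = min (\<epsilon> powr \<alpha>) (enn2real (min 1 P))"
  have P1: "min 1 P \<noteq> \<top>" by (metis ennreal_one_neq_top min.cobounded1 top.extremum_uniqueI)
  have c: "0 < c" "c \<le> \<epsilon> powr \<alpha>" "ennreal c \<le> P"
  proof -
    have "0 < min 1 P" using \<epsilon> by (simp add: P_def zero_less_iff_neq_zero)
    then have "0 < enn2real (min 1 P)" using P1 by (simp add: enn2real_positive_iff top.not_eq_extremum)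
    then show "0 < c" using \<epsilon> by (simp add: c_def)
    show "c \<le> \<epsilon> powr \<alpha>" by (simp add: c_def)
    have "ennreal c \<le> ennreal (enn2real (min 1 P))" by (intro ennreal_leI) (simp add: c_def)
    also have "\<dots> \<le> P" using P1 by (simp add: top.not_eq_extremum)
    finally show "ennreal c \<le> P" .
  qed
  have "c \<le> min_cut B m n []" for n
  proof (rule ccontr)
    assume "\<not> c \<le> min_cut B m n []"
    moreover obtain cs where cs: "(\<Sum>u\<leftarrow>cs. (1 / m) ^ length u) \<le> min_cut B m n []"
      "\<And>w. w \<in> descendants B n [] \<Longrightarrow> \<exists>u\<in>set cs. take (length u) w = u"
      using min_cut_attained[of m B n "[]"] m by auto
    ultimately have small: "(\<Sum>u\<leftarrow>cs. (1 / m) ^ length u) < c" by linarith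
    have exp_powr: "exp (- real k) powr \<alpha> = (1 / m) ^ k" for k
    proof -
      have "exp (- real k) powr \<alpha> = exp (- ln m) ^ k"
        by (simp add: powr_def \<alpha>_def exp_of_nat_mult[symmetric])
      then show ?thesis using m by (simp add: exp_minus inverse_eq_divide)
    qed
    define U where "U i = (if i < length cs then {x \<in> ?S. map x [0..<length (cs ! i)] = cs ! i} else {})" for i
    have diam: "set_diam boundary_dist (U i) \<le> ennreal (exp (- real (length (cs ! i))))" if "i < length cs" for i
      using that by (simp add: U_def set_diam_cylinder)
    have diam0: "set_diam boundary_dist (U i) = 0" if "\<not> i < length cs" for i
      using that by (simp add: U_def set_diam_def bot_ennreal)
    have "set_diam boundary_dist (U i) \<le> ennreal \<epsilon>" for i
    proof (cases "i < length cs")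
      case True
      have "(1 / m) ^ length (cs ! i) \<le> (\<Sum>u\<leftarrow>cs. (1 / m) ^ length u)"
        using True m by (intro member_le_sum_list) auto
      then have "exp (- real (length (cs ! i))) powr \<alpha> \<le> \<epsilon> powr \<alpha>"
        using small c exp_powr by simp
      then have "exp (- real (length (cs ! i))) \<le> \<epsilon>"
        using \<alpha> \<epsilon> by (metis exp_ge_zero less_imp_le not_le powr_less_mono2)
      then show ?thesis using diam[OF True] by (meson ennreal_leI order_trans)
    qed (simp add: diam0)
    moreover have "U i \<subseteq> ?S" for i by (auto simp: U_def)
    moreover have "?S \<subseteq> (\<Union>i. U i)"
    proof
      fix x assume x: "x \<in> ?S"
      then have "map x [0..<n] \<in> tree_vertices B" by (auto simp: tree_boundary_def)
      then obtain n' where n': "map x [0..<n] \<in> tree_level B n'" by (auto simp: tree_vertices_def)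
      then have "n' = n" by (auto simp: tree_level_def)
      then have "map x [0..<n] \<in> descendants B n []" using n' by (simp add: tree_level_eq_descendants)
      then obtain u where u: "u \<in> set cs" "take (length u) (map x [0..<n]) = u" using cs(2) by blast
      have le: "length u \<le> n"
      proof -
        have "length u = length (take (length u) (map x [0..<n]))" using u by simp
        then show ?thesis by simp
      qed
      have "map x [0..<length u] = u" using u(2) le by (simp add: take_map)
      moreover obtain i where "i < length cs" "cs ! i = u" using u(1) by (auto simp: in_set_conv_nth)
      ultimately have "x \<in> U i" using x by (simp add: U_def)
      then show "x \<in> (\<Union>i. U i)" by blast
    qed
    ultimately have "P \<le> (\<Sum>i. ennreal (enn2real (set_diam boundary_dist (U i)) powr \<alpha>))"
      unfolding P_def hausdorff_premeasure_def by (intro INF_lower) blast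
    also have "\<dots> = (\<Sum>i<length cs. ennreal (enn2real (set_diam boundary_dist (U i)) powr \<alpha>))"
      using diam0 by (intro suminf_finite) auto
    also have "\<dots> \<le> (\<Sum>i<length cs. ennreal ((1 / m) ^ length (cs ! i)))"
    proof (intro sum_mono ennreal_leI)
      fix i assume "i \<in> {..<length cs}"
      then have "enn2real (set_diam boundary_dist (U i)) \<le> exp (- real (length (cs ! i)))"
        using diam by (intro enn2real_leI) auto
      then show "enn2real (set_diam boundary_dist (U i)) powr \<alpha> \<le> (1 / m) ^ length (cs ! i)"
        unfolding exp_powr[symmetric] using \<alpha> by (intro powr_mono2) auto
    qed
    also have "\<dots> = ennreal (\<Sum>i<length cs. (1 / m) ^ length (cs ! i))"
      using m by (intro sum_ennreal) auto
    also have "(\<Sum>i<length cs. (1 / m) ^ length (cs ! i)) = (\<Sum>u\<leftarrow>cs. (1 / m) ^ length u)"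
      by (simp add: sum_list_sum_nth atLeast0LessThan)
    also have "ennreal \<dots> < ennreal c" using small c by (intro ennreal_lessI) auto
    finally show False using c(3) by simp
  qed
  then show thesis using c(1) that by blast
qed

section \<open>Matrix products along segments of the tree\<close>

text \<open>
  The increments of \<open>path_product\<close>: a path product always starts at the root, whereas products over
  disjoint segments are independent.
\<close>
primrec segment_product ::
  "(nat list \<times> nat list \<Rightarrow> real^'n^'n) \<Rightarrow> nat list \<Rightarrow> nat \<Rightarrow> nat \<Rightarrow> real^'n^'n" where
  "segment_product x v a 0 = mat 1"
| "segment_product x v a (Suc k) = x (edge_to (take (a + Suc k) v)) ** segment_product x v a k"

definition segment_edges :: "nat list \<Rightarrow> nat \<Rightarrow> nat \<Rightarrow> (nat list \<times> nat list) set" where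
  "segment_edges v a k = (\<lambda>l. edge_to (take l v)) ` {a<..a + k}"

lemma segment_edges_0 [simp]: "segment_edges v a 0 = {}"
  by (simp add: segment_edges_def)

lemma segment_edges_Suc: "segment_edges v a (Suc k) = insert (edge_to (take (a + Suc k) v)) (segment_edges v a k)"
proof -
  have "{a<..a + Suc k} = insert (a + Suc k) {a<..a + k}" by auto
  then show ?thesis by (simp add: segment_edges_def)
qed

lemma path_product_add: "path_product x v (a + k) = segment_product x v a k ** path_product x v a"
  by (induction k) (simp_all add: matrix_mul_assoc)

lemma segment_product_cong:
  "(\<And>e. e \<in> segment_edges v a k \<Longrightarrow> x e = y e) \<Longrightarrow> segment_product x v a k = segment_product y v a k"
  by (induction k) (simp_all add: segment_edges_Suc)

lemma segment_product_take:
  assumes "a + k \<le> n"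
  shows "segment_product x (take n v) a k = segment_product x v a k"
  using assms by (induction k) (simp_all add: min_def)

lemma edge_to_inj: "edge_to u = edge_to v \<Longrightarrow> u = v"
  by (simp add: edge_to_def)

lemma last_edge_notin_segment:
  assumes "a + Suc k \<le> length v"
  shows "edge_to (take (a + Suc k) v) \<notin> segment_edges v a k"
proof
  assume "edge_to (take (a + Suc k) v) \<in> segment_edges v a k"
  then obtain l where "l \<in> {a<..a + k}" "take (a + Suc k) v = take l v"
    by (auto simp: segment_edges_def dest: edge_to_inj)
  then have "length (take (a + Suc k) v) = length (take l v)" "l < a + Suc k" by auto
  then show False using assms by simp
qed

lemma take_in_tree_level: "v \<in> tree_level B n \<Longrightarrow> l \<le> n \<Longrightarrow> take l v \<in> tree_level B l"
  by (auto simp: tree_level_def min_def)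

lemma segment_edges_subset:
  assumes v: "v \<in> tree_level B n" and le: "a + k \<le> n"
  shows "segment_edges v a k \<subseteq> tree_edges B"
proof -
  have "take l v \<in> tree_vertices B - {[]}" if "l \<in> {a<..a + k}" for l
    using that le v take_in_tree_level[OF v, of l] by (auto simp: tree_vertices_def tree_level_def)
  then show ?thesis by (auto simp: segment_edges_def tree_edges_def)
qed

lemma finite_tree_level [simp]: "finite (tree_level B n)"
  by (simp add: tree_level_eq_descendants)

lemma measurable_segment_product:
  assumes "segment_edges v a k \<subseteq> E" and "\<And>e. e \<in> E \<Longrightarrow> (\<lambda>y. x y e) \<in> measurable N GL_borel"
  shows "(\<lambda>y. segment_product (x y) v a k) \<in> measurable N GL_borel"
  using assms
proof (induction k)
  case 0
  then show ?case by (simp add: space_GL_borel mat_1_in_GL)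
next
  case (Suc k)
  then show ?case unfolding segment_product.simps
    by (intro measurable_GL_mult) (auto simp: segment_edges_Suc)
qed

locale iid_cascade = positive_matrix_law \<mu> + P: prob_space M
  for \<mu> :: "(real^'n^'n) measure" and M :: "'w measure" +
  fixes B :: "nat list \<Rightarrow> nat" and \<xi> :: "nat list \<times> nat list \<Rightarrow> 'w \<Rightarrow> real^'n^'n"
  assumes xi_indep: "P.indep_vars (\<lambda>_. GL_borel) \<xi> (tree_edges B)"
    and xi_law: "\<And>a. a \<in> tree_edges B \<Longrightarrow> distr M GL_borel (\<xi> a) = \<mu>"
begin

lemma measurable_xi: "e \<in> tree_edges B \<Longrightarrow> \<xi> e \<in> measurable M GL_borel"
  using xi_indep by (simp add: P.indep_vars_def2)

lemma measurable_segment: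
  assumes "v \<in> tree_level B n" "a + k \<le> n"
  shows "(\<lambda>\<omega>. segment_product (\<lambda>e. \<xi> e \<omega>) v a k) \<in> measurable M GL_borel"
  by (rule measurable_segment_product[OF segment_edges_subset[OF assms]]) (rule measurable_xi)

lemma measurable_segment_PiM:
  assumes "segment_edges v a k \<subseteq> E"
  shows "(\<lambda>x. segment_product x v a k) \<in> measurable (PiM E (\<lambda>_. GL_borel)) GL_borel"
  by (rule measurable_segment_product[OF assms]) (rule measurable_component_singleton)

text \<open>
  The last edge of the segment is independent of the earlier ones, which reproduces the recursion of
  the convolution powers.
\<close>
lemma segment_law:
  assumes v: "v \<in> tree_level B n" and le: "a + k \<le> n"
  shows "distr M GL_borel (\<lambda>\<omega>. segment_product (\<lambda>e. \<xi> e \<omega>) v a k) = conv k"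
  using le
proof (induction k)
  case 0
  have "distr M GL_borel (\<lambda>\<omega>. mat 1 :: real^'n^'n) = return GL_borel (mat 1)"
    by (rule P.distr_const) (simp add: space_GL_borel mat_1_in_GL)
  then show ?case by simp
next
  case (Suc k)
  let ?e = "edge_to (take (a + Suc k) v)" and ?E = "segment_edges v a k"
  let ?X = "\<xi> ?e" and ?Y = "\<lambda>\<omega>. segment_product (\<lambda>e. \<xi> e \<omega>) v a k"
  have sub: "insert ?e ?E \<subseteq> tree_edges B"
    using segment_edges_subset[OF v Suc.prems] by (simp add: segment_edges_Suc)
  have len: "length v = n" using v by (simp add: tree_level_def)
  have "P.indep_var (PiM {?e} (\<lambda>_. GL_borel)) (\<lambda>\<omega>. restrict (\<lambda>i. \<xi> i \<omega>) {?e})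
     (PiM ?E (\<lambda>_. GL_borel)) (\<lambda>\<omega>. restrict (\<lambda>i. \<xi> i \<omega>) ?E)"
    using sub Suc.prems last_edge_notin_segment[of a k v] len by (intro P.indep_var_restrict[OF xi_indep]) auto
  then have "P.indep_var GL_borel ((\<lambda>x. x ?e) \<circ> (\<lambda>\<omega>. restrict (\<lambda>i. \<xi> i \<omega>) {?e}))
     GL_borel ((\<lambda>x. segment_product x v a k) \<circ> (\<lambda>\<omega>. restrict (\<lambda>i. \<xi> i \<omega>) ?E))"
    by (rule P.indep_var_compose) (auto intro!: measurable_component_singleton measurable_segment_PiM)
  moreover have "(\<lambda>x. x ?e) \<circ> (\<lambda>\<omega>. restrict (\<lambda>i. \<xi> i \<omega>) {?e}) = ?X" by (auto simp: fun_eq_iff)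
  moreover have "(\<lambda>x. segment_product x v a k) \<circ> (\<lambda>\<omega>. restrict (\<lambda>i. \<xi> i \<omega>) ?E) = ?Y"
    by (auto simp: fun_eq_iff intro!: segment_product_cong)
  ultimately have "P.indep_var GL_borel ?X GL_borel ?Y" by simp
  then have "distr M GL_borel ?X \<Otimes>\<^sub>M distr M GL_borel ?Y = distr M (GL_borel \<Otimes>\<^sub>M GL_borel) (\<lambda>\<omega>. (?X \<omega>, ?Y \<omega>))"
    by (simp add: P.indep_var_distribution_eq)
  then have joint: "\<mu> \<Otimes>\<^sub>M conv k = distr M (GL_borel \<Otimes>\<^sub>M GL_borel) (\<lambda>\<omega>. (?X \<omega>, ?Y \<omega>))"
    using Suc sub by (simp add: xi_law)
  have mX: "?X \<in> measurable M GL_borel" using sub by (intro measurable_xi) auto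
  have mY: "?Y \<in> measurable M GL_borel" using Suc.prems by (intro measurable_segment[OF v]) auto
  have mult: "(\<lambda>(g, h). g ** h) \<in> measurable (GL_borel \<Otimes>\<^sub>M GL_borel) (GL_borel :: (real^'n^'n) measure)"
    by measurable
  have "conv (Suc k) = distr (distr M (GL_borel \<Otimes>\<^sub>M GL_borel) (\<lambda>\<omega>. (?X \<omega>, ?Y \<omega>))) GL_borel (\<lambda>(g, h). g ** h)"
    unfolding convolution_power.simps joint ..
  also have "\<dots> = distr M GL_borel ((\<lambda>(g, h). g ** h) \<circ> (\<lambda>\<omega>. (?X \<omega>, ?Y \<omega>)))"
    by (rule distr_distr[OF mult measurable_Pair[OF mX mY]])
  finally show ?case by (simp add: comp_def)
qed

lemma AE_xi_pos: "AE \<omega> in M. \<forall>e\<in>tree_edges B. 0 < min_entry (\<xi> e \<omega>)"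
proof -
  have "countable (tree_edges B)"
    unfolding tree_edges_def by (rule countable_image) simp
  moreover have "AE \<omega> in M. 0 < min_entry (\<xi> e \<omega>)" if "e \<in> tree_edges B" for e
  proof -
    have "AE g in distr M GL_borel (\<xi> e). 0 < min_entry g"
      unfolding xi_law[OF that] by (rule AE_pos)
    then show ?thesis
      by (rule AE_distrD[OF measurable_xi[OF that]])
  qed
  ultimately show ?thesis by (simp add: AE_ball_countable)
qed

end

section \<open>Block percolation and the second moment method\<close>

locale block_percolation = iid_cascade \<mu> M B \<xi>
  for \<mu> :: "(real^'n^'n) measure" and M :: "'w measure" and B \<xi> +
  fixes L :: nat and \<tau> q :: real
  assumes L_pos: "1 \<le> L"
    and q_def: "q = measure (conv L) {g \<in> GL. \<tau> \<le> min_entry g}"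
begin

text \<open>
  Block \<open>i\<close> of a path consists of the \<open>L\<close> edges that follow level \<open>i * L\<close>.
\<close>
definition good :: "nat list \<Rightarrow> nat \<Rightarrow> 'w \<Rightarrow> bool" where
  "good v i \<omega> \<longleftrightarrow> \<tau> \<le> min_entry (segment_product (\<lambda>e. \<xi> e \<omega>) v (i * L) L)"

text \<open>
  The blocks before \<open>j\<close> are left unconstrained. This keeps the weight of the
  open vertices concentrated, since paths that separate before level \<open>j * L\<close> are then independent.
\<close>
definition open_from :: "nat \<Rightarrow> nat \<Rightarrow> nat list \<Rightarrow> 'w set" where
  "open_from j n v = {\<omega> \<in> space M. \<forall>i\<in>{j..<n}. good v i \<omega>}"

lemma block_le: "i < n \<Longrightarrow> i * L + L \<le> n * L"
  by (metis Suc_leI add.commute mult_Suc mult_le_mono1)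

lemma good_event:
  assumes v: "v \<in> tree_level B (n * L)" and i: "i < n"
  shows "{\<omega> \<in> space M. good v i \<omega>} \<in> sets M"
proof -
  have "{\<omega> \<in> space M. good v i \<omega>}
     = (\<lambda>\<omega>. segment_product (\<lambda>e. \<xi> e \<omega>) v (i * L) L) -` {g \<in> GL. \<tau> \<le> min_entry g} \<inter> space M"
    using measurable_space[OF measurable_segment[OF v block_le[OF i]]]
    by (auto simp: good_def space_GL_borel)
  then show ?thesis
    using measurable_sets[OF measurable_segment[OF v block_le[OF i]] sets_min_entry_ge] by simp
qed

lemma open_from_event: "v \<in> tree_level B (n * L) \<Longrightarrow> open_from j n v \<in> sets M"
proof -
  assume v: "v \<in> tree_level B (n * L)"
  have "open_from j n v = space M \<inter> (\<Inter>i\<in>{j..<n}. {\<omega> \<in> space M. good v i \<omega>})"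
    by (auto simp: open_from_def)
  also have "\<dots> \<in> sets M"
    using good_event[OF v] by (cases "{j..<n} = {}") (auto intro!: sets.Int sets.finite_INT)
  finally show ?thesis .
qed

lemma independent_blocks:
  assumes fin: "finite I"
    and lev: "\<And>p. p \<in> I \<Longrightarrow> fst p \<in> tree_level B (n * L) \<and> snd p < n"
    and disj: "disjoint_family_on (\<lambda>p. segment_edges (fst p) (snd p * L) L) I"
  shows "P.prob {\<omega> \<in> space M. \<forall>p\<in>I. good (fst p) (snd p) \<omega>} = q ^ card I"
proof (cases "I = {}")
  case True
  then show ?thesis by (simp add: P.prob_space)
next
  case False
  let ?K = "\<lambda>p. segment_edges (fst p) (snd p * L) L"
  let ?Y = "\<lambda>p \<omega>. segment_product (\<lambda>e. \<xi> e \<omega>) (fst p) (snd p * L) L"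
  let ?A = "{g \<in> GL. \<tau> \<le> min_entry (g :: real^'n^'n)}"
  have sub: "?K p \<subseteq> tree_edges B" if "p \<in> I" for p
    using lev[OF that] block_le by (intro segment_edges_subset) auto
  have "P.indep_vars (\<lambda>p. PiM (?K p) (\<lambda>_. GL_borel)) (\<lambda>p \<omega>. restrict (\<lambda>e. \<xi> e \<omega>) (?K p)) I"
    by (rule P.indep_vars_restrict[OF xi_indep sub disj])
  then have "P.indep_vars (\<lambda>_. GL_borel)
      (\<lambda>p \<omega>. segment_product (restrict (\<lambda>e. \<xi> e \<omega>) (?K p)) (fst p) (snd p * L) L) I"
    by (rule P.indep_vars_compose2[where Y = "\<lambda>p x. segment_product x (fst p) (snd p * L) L"])
       (rule measurable_segment_PiM, simp)
  moreover have "segment_product (restrict (\<lambda>e. \<xi> e \<omega>) (?K p)) (fst p) (snd p * L) L = ?Y p \<omega>" for p \<omega>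
    by (rule segment_product_cong) simp
  ultimately have ind: "P.indep_vars (\<lambda>_. GL_borel) ?Y I" by simp
  have "{\<omega> \<in> space M. \<forall>p\<in>I. good (fst p) (snd p) \<omega>} = (\<Inter>p\<in>I. ?Y p -` ?A \<inter> space M)"
    using False measurable_space[OF measurable_segment[OF conjunct1[OF lev] block_le[OF conjunct2[OF lev]]]]
    by (auto simp: good_def space_GL_borel)
  also have "P.prob \<dots> = (\<Prod>p\<in>I. P.prob (?Y p -` ?A \<inter> space M))"
    by (rule P.indep_varsD[OF ind False fin subset_refl]) (rule sets_min_entry_ge)
  also have "\<dots> = (\<Prod>p\<in>I. q)"
  proof (rule prod.cong[OF refl])
    fix p assume "p \<in> I"
    then have p: "fst p \<in> tree_level B (n * L)" "snd p * L + L \<le> n * L" using lev block_le by auto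
    have "P.prob (?Y p -` ?A \<inter> space M) = measure (distr M GL_borel (?Y p)) ?A"
      by (rule measure_distr[OF measurable_segment[OF p] sets_min_entry_ge, symmetric])
    then show "P.prob (?Y p -` ?A \<inter> space M) = q"
      by (simp add: segment_law[OF p] q_def)
  qed
  finally show ?thesis by simp
qed

end

text \<open>
  An edge determines its lower endpoint, hence its level and all ancestors of that endpoint.
\<close>
lemma segments_disjoint:
  assumes len: "length v = n * L" "length w = n * L" and i: "i < n" "i' < n"
    and differ: "i \<noteq> i' \<or> take (i * L) v \<noteq> take (i * L) w"
  shows "segment_edges v (i * L) L \<inter> segment_edges w (i' * L) L = {}"
proof (rule ccontr)
  assume "\<not> ?thesis"
  then obtain l l' where l: "i * L < l" "l \<le> i * L + L" "i' * L < l'" "l' \<le> i' * L + L"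
    "edge_to (take l v) = edge_to (take l' w)"
    by (fastforce simp: segment_edges_def)
  note l = l(1-4) edge_to_inj[OF l(5)]
  have block: "k * L + L \<le> k' * L" if "k < k'" for k k' :: nat
    using mult_le_mono1[of "Suc k" k' L] that by simp
  have "length (take l v) = l" using len(1) l(2) block[OF i(1)] by simp
  moreover have "length (take l' w) = l'" using len(2) l(4) block[OF i(2)] by simp
  ultimately have l': "l = l'" using l(5) by metis
  have "i = i'"
    using l l' block[of i i'] block[of i' i] by (cases i i' rule: linorder_cases) auto
  moreover have "take (i * L) v = take (i * L) w"
  proof -
    have "take (i * L) v = take (i * L) (take l v)" using l(1) by (simp add: min_def)
    also have "\<dots> = take (i * L) (take l w)" using l(5) l' by simp
    also have "\<dots> = take (i * L) w" using l(1) by (simp add: min_def)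
    finally show ?thesis .
  qed
  ultimately show False using differ by simp
qed

context block_percolation
begin

lemma level_length: "v \<in> tree_level B k \<Longrightarrow> length v = k"
  by (simp add: tree_level_def)

lemma prob_open_from:
  assumes v: "v \<in> tree_level B (n * L)"
  shows "P.prob (open_from j n v) = q ^ (n - j)"
proof -
  have "P.prob {\<omega> \<in> space M. \<forall>p\<in>{v} \<times> {j..<n}. good (fst p) (snd p) \<omega>} = q ^ card ({v} \<times> {j..<n})"
  proof (rule independent_blocks)
    show "disjoint_family_on (\<lambda>p. segment_edges (fst p) (snd p * L) L) ({v} \<times> {j..<n})"
      unfolding disjoint_family_on_def
      by (intro ballI impI segments_disjoint[of _ n]) (auto simp: level_length[OF v])
  qed (use v in auto)
  then show ?thesis by (simp add: open_from_def)
qed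

text \<open>
  Of the second path only the blocks from \<open>i\<close> on are used, which lie strictly below the branch point;
  the block containing the branch point is partly shared and is simply dropped. At level \<open>n\<close>
  itself nothing is left of the second path, which covers \<open>v = w\<close>.
\<close>
lemma prob_open_from_both:
  assumes v: "v \<in> tree_level B (n * L)" and w: "w \<in> tree_level B (n * L)"
    and i: "j \<le> i" "i \<le> n" and differ: "i < n \<Longrightarrow> take (i * L) v \<noteq> take (i * L) w"
  shows "P.prob (open_from j n v \<inter> open_from j n w) \<le> q ^ ((n - j) + (n - i))"
proof -
  let ?I = "{v} \<times> {j..<n} \<union> {w} \<times> {i..<n}"
  have differ': "take (k * L) v \<noteq> take (k * L) w" if "i \<le> k" "k < n" for k
  proof
    assume "take (k * L) v = take (k * L) w"
    then have "take (i * L) (take (k * L) v) = take (i * L) (take (k * L) w)" by simp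
    then show False using differ that by (simp add: min_def)
  qed
  have lv: "length v = n * L" "length w = n * L" using v w level_length by auto
  have "card ?I = card ({v} \<times> {j..<n}) + card ({w} \<times> {i..<n})"
    using differ by (intro card_Un_disjoint) auto
  then have card: "card ?I = (n - j) + (n - i)" by (simp add: card_cartesian_product)
  have "disjoint_family_on (\<lambda>p. segment_edges (fst p) (snd p * L) L) ?I"
    unfolding disjoint_family_on_def
  proof (intro ballI impI)
    fix p p' assume p: "p \<in> ?I" "p' \<in> ?I" "p \<noteq> p'"
    show "segment_edges (fst p) (snd p * L) L \<inter> segment_edges (fst p') (snd p' * L) L = {}"
      by (rule segments_disjoint[of _ n]) (use p lv differ' in \<open>auto simp: eq_commute[of "take _ w"]\<close>)
  qed
  then have "P.prob {\<omega> \<in> space M. \<forall>p\<in>?I. good (fst p) (snd p) \<omega>} = q ^ card ?I"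
    using v w by (intro independent_blocks[where n = n]) auto
  moreover have "P.prob (open_from j n v \<inter> open_from j n w)
      \<le> P.prob {\<omega> \<in> space M. \<forall>p\<in>?I. good (fst p) (snd p) \<omega>}"
  proof (rule P.finite_measure_mono)
    have "{\<omega> \<in> space M. \<forall>p\<in>?I. good (fst p) (snd p) \<omega>} = open_from j n v \<inter> open_from i n w"
      by (auto simp: open_from_def ball_Un)
    then show "{\<omega> \<in> space M. \<forall>p\<in>?I. good (fst p) (snd p) \<omega>} \<in> P.events"
      using open_from_event v w by auto
  qed (use i in \<open>auto simp: open_from_def\<close>)
  ultimately show ?thesis using card by simp
qed

text \<open>
  Replacing the last block level at which the paths agree by the sum over all such levels makes the
  bound additive, so that it can be integrated against a flow.
\<close>
lemma prob_open_from_both_sum: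
  assumes v: "v \<in> tree_level B (n * L)" and w: "w \<in> tree_level B (n * L)"
    and j: "j \<le> n" and q: "0 < q"
  shows "P.prob (open_from j n v \<inter> open_from j n w)
    \<le> (q ^ (n - j))\<^sup>2 * (1 + (\<Sum>i\<in>{j..<n}. (1 / q) ^ (i + 1 - j) * of_bool (take (i * L) v = take (i * L) w)))"
    (is "_ \<le> _ * (1 + ?S)")
proof -
  have S: "0 \<le> ?S" using q by (intro sum_nonneg) auto
  show ?thesis
  proof (cases "j < n \<and> take (j * L) v = take (j * L) w")
    case False
    have "P.prob (open_from j n v \<inter> open_from j n w) \<le> q ^ ((n - j) + (n - j))"
      using False j by (intro prob_open_from_both v w) auto
    also have "\<dots> = (q ^ (n - j))\<^sup>2 * 1" by (simp add: power_add power2_eq_square)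
    also have "\<dots> \<le> (q ^ (n - j))\<^sup>2 * (1 + ?S)" using S by (intro mult_left_mono) auto
    finally show ?thesis .
  next
    case True
    define A where "A = {i \<in> {j..<n}. take (i * L) v = take (i * L) w}"
    define i where "i = Max A"
    have A: "finite A" "j \<in> A" using True by (auto simp: A_def)
    then have "i \<in> A" unfolding i_def by (intro Max_in) auto
    then have i: "j \<le> i" "i < n" "take (i * L) v = take (i * L) w" by (auto simp: A_def)
    have "take (Suc i * L) v \<noteq> take (Suc i * L) w" if "Suc i < n"
    proof
      assume "take (Suc i * L) v = take (Suc i * L) w"
      then have "Suc i \<in> A" using that i by (auto simp: A_def)
      then have "Suc i \<le> i" unfolding i_def using A by (intro Max_ge) auto
      then show False by simp
    qed
    then have "P.prob (open_from j n v \<inter> open_from j n w) \<le> q ^ ((n - j) + (n - Suc i))"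
      using i by (intro prob_open_from_both v w) auto
    also have "\<dots> = (q ^ (n - j))\<^sup>2 * (1 / q) ^ (i + 1 - j)"
    proof -
      have "n - j = (n - Suc i) + (i + 1 - j)" using i by simp
      then have "q ^ (n - j) = q ^ (n - Suc i) * q ^ (i + 1 - j)" by (metis power_add)
      then show ?thesis using q by (simp add: power_add power2_eq_square power_one_over)
    qed
    also have "\<dots> \<le> (q ^ (n - j))\<^sup>2 * (1 + ?S)"
    proof (intro mult_left_mono)
      have "(1 / q) ^ (i + 1 - j) * of_bool (take (i * L) v = take (i * L) w) \<le> ?S"
        using i q by (intro member_le_sum) auto
      then show "(1 / q) ^ (i + 1 - j) \<le> 1 + ?S" using i by simp
    qed simp
    finally show ?thesis .
  qed
qed

text \<open>
  Chebyshev's inequality for the flow carried by the open vertices. The flow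
  through a vertex at level \<open>i * L\<close> is at most \<open>m ^ (- i * L)\<close>, while agreement up to that level
  multiplies the correlation by at most \<open>q ^ (- (i + 1 - j))\<close>; the products are summable because \<open>q * m ^ L > 1\<close>.
  The same capacity bound at the last level converts flow into a number of vertices.
\<close>
lemma few_open_paths_unlikely:
  assumes q: "0 < q" and m: "0 < m" and qm: "1 < q * m ^ L"
    and c: "0 < c" "c \<le> min_cut B m (n * L) []" and j: "j \<le> n"
  shows "P.prob {\<omega> \<in> space M. (\<Sum>v\<in>tree_level B (n * L). indicator (open_from j n v) \<omega>)
      < c / 2 * (q ^ (n - j) * m ^ (n * L))}
    \<le> 4 / (c * q * (1 - 1 / (q * m ^ L))) * (1 / m ^ L) ^ j"
proof -
  let ?T = "tree_level B (n * L)"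
  obtain f :: "nat list \<Rightarrow> real" where f: "\<And>w. 0 \<le> f w" "(\<Sum>w\<in>?T. f w) = c"
    and F: "\<And>u. (\<Sum>w\<in>{w \<in> ?T. take (length u) w = u}. f w) \<le> (1 / m) ^ length u"
    using flow_below_min_cut[of m c B "n * L" "[]"] m c by (auto simp: tree_level_eq_descendants)
  define W where "W \<omega> = (\<Sum>v\<in>?T. f v * indicator (open_from j n v) \<omega>)" for \<omega>
  define Q where "Q = q ^ (n - j)"
  have Q: "0 < Q" using q by (simp add: Q_def)
  have int1: "integrable M (\<lambda>\<omega>. f v * indicator (open_from j n v) \<omega>)" if "v \<in> ?T" for v
    using open_from_event[OF that] by (intro integrable_mult_right) (simp add: P.emeasure_eq_measure)
  have EW: "P.expectation W = c * Q"
  proof -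
    have "P.expectation W = (\<Sum>v\<in>?T. P.expectation (\<lambda>\<omega>. f v * indicator (open_from j n v) \<omega>))"
      unfolding W_def using int1 by (intro Bochner_Integration.integral_sum) auto
    also have "\<dots> = (\<Sum>v\<in>?T. f v * Q)"
      using open_from_event prob_open_from by (intro sum.cong) (auto simp: Q_def)
    finally show ?thesis using f(2) by (simp add: sum_distrib_right[symmetric])
  qed
  have W2: "(W \<omega>)\<^sup>2 = (\<Sum>v\<in>?T. \<Sum>w\<in>?T. f v * f w * indicator (open_from j n v \<inter> open_from j n w) \<omega>)" for \<omega>
    unfolding W_def power2_eq_square sum_product
    by (intro sum.cong refl) (auto simp: indicator_def)
  have int2: "integrable M (\<lambda>\<omega>. f v * f w * indicator (open_from j n v \<inter> open_from j n w) \<omega>)"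
    if "v \<in> ?T" "w \<in> ?T" for v w
    using open_from_event[OF that(1)] open_from_event[OF that(2)]
    by (intro integrable_mult_right) (simp add: P.emeasure_eq_measure sets.Int)
  have intW2: "integrable M (\<lambda>\<omega>. (W \<omega>)\<^sup>2)"
    unfolding W2 using int2 by (intro Bochner_Integration.integrable_sum) auto
  have W_meas: "W \<in> borel_measurable M"
    unfolding W_def[abs_def] by (intro borel_measurable_sum borel_measurable_integrable int1)
  define b where "b i = (1 / q) ^ (i + 1 - j)" for i
  have expand: "(\<Sum>v\<in>?T. \<Sum>w\<in>?T. f v * f w * (Q\<^sup>2 * (1 + (\<Sum>i\<in>{j..<n}. b i * s i v w))))
      = Q\<^sup>2 * ((\<Sum>v\<in>?T. \<Sum>w\<in>?T. f v * f w) + (\<Sum>i\<in>{j..<n}. b i * (\<Sum>v\<in>?T. f v * (\<Sum>w\<in>?T. f w * s i v w))))"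
    for s :: "nat \<Rightarrow> nat list \<Rightarrow> nat list \<Rightarrow> real"
  proof -
    have "(\<Sum>v\<in>?T. \<Sum>w\<in>?T. \<Sum>i\<in>{j..<n}. f v * f w * (Q\<^sup>2 * (b i * s i v w)))
        = (\<Sum>v\<in>?T. \<Sum>i\<in>{j..<n}. \<Sum>w\<in>?T. f v * f w * (Q\<^sup>2 * (b i * s i v w)))"
      by (intro sum.cong refl sum.swap)
    also have "\<dots> = (\<Sum>i\<in>{j..<n}. \<Sum>v\<in>?T. \<Sum>w\<in>?T. f v * f w * (Q\<^sup>2 * (b i * s i v w)))"
      by (rule sum.swap)
    finally show ?thesis
      by (simp add: distrib_left sum.distrib sum_distrib_left ac_simps)
  qed
  have "P.expectation (\<lambda>\<omega>. (W \<omega>)\<^sup>2)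
      = (\<Sum>v\<in>?T. \<Sum>w\<in>?T. f v * f w * P.prob (open_from j n v \<inter> open_from j n w))"
  proof -
    have "P.expectation (\<lambda>\<omega>. (W \<omega>)\<^sup>2) = (\<Sum>v\<in>?T. P.expectation (\<lambda>\<omega>.
        \<Sum>w\<in>?T. f v * f w * indicator (open_from j n v \<inter> open_from j n w) \<omega>))"
      unfolding W2 using int2
      by (intro Bochner_Integration.integral_sum Bochner_Integration.integrable_sum) auto
    also have "\<dots> = (\<Sum>v\<in>?T. \<Sum>w\<in>?T. P.expectation (\<lambda>\<omega>.
        f v * f w * indicator (open_from j n v \<inter> open_from j n w) \<omega>))"
      using int2 by (intro sum.cong Bochner_Integration.integral_sum) auto
    also have "\<dots> = (\<Sum>v\<in>?T. \<Sum>w\<in>?T. f v * f w * P.prob (open_from j n v \<inter> open_from j n w))"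
      using open_from_event by (intro sum.cong refl) (auto simp: sets.Int Int_absorb2 sets.sets_into_space)
    finally show ?thesis .
  qed
  also have "\<dots> \<le> (\<Sum>v\<in>?T. \<Sum>w\<in>?T. f v * f w *
      (Q\<^sup>2 * (1 + (\<Sum>i\<in>{j..<n}. b i * of_bool (take (i * L) v = take (i * L) w)))))"
    unfolding Q_def b_def using f(1) q j
    by (intro sum_mono mult_left_mono prob_open_from_both_sum) auto
  also have "\<dots> = Q\<^sup>2 * ((\<Sum>v\<in>?T. \<Sum>w\<in>?T. f v * f w) + (\<Sum>i\<in>{j..<n}. b i *
      (\<Sum>v\<in>?T. f v * (\<Sum>w\<in>?T. f w * of_bool (take (i * L) v = take (i * L) w)))))"
    by (rule expand)
  also have "(\<Sum>v\<in>?T. \<Sum>w\<in>?T. f v * f w) = c\<^sup>2"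
    by (simp add: sum_product[symmetric] f(2) power2_eq_square)
  also have "Q\<^sup>2 * (c\<^sup>2 + (\<Sum>i\<in>{j..<n}. b i *
      (\<Sum>v\<in>?T. f v * (\<Sum>w\<in>?T. f w * of_bool (take (i * L) v = take (i * L) w)))))
    \<le> Q\<^sup>2 * (c\<^sup>2 + (\<Sum>i\<in>{j..<n}. b i * (\<Sum>v\<in>?T. f v * (1 / m) ^ (i * L))))"
  proof (intro mult_left_mono add_left_mono sum_mono)
    fix i v assume i: "i \<in> {j..<n}" and v: "v \<in> ?T"
    let ?u = "take (i * L) v"
    have "i * L \<le> n * L" using i by (intro mult_le_mono1) auto
    then have len: "length ?u = i * L" using level_length[OF v] by simp
    have "(\<Sum>w\<in>?T. f w * of_bool (take (i * L) v = take (i * L) w))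
        = (\<Sum>w\<in>?T. if take (i * L) w = ?u then f w else 0)"
      by (intro sum.cong) auto
    also have "\<dots> = (\<Sum>w\<in>{w \<in> ?T. take (length ?u) w = ?u}. f w)"
      unfolding len by (rule sum.inter_filter[symmetric]) simp
    also have "\<dots> \<le> (1 / m) ^ (i * L)" using F[of ?u] len by simp
    finally show "(\<Sum>w\<in>?T. f w * of_bool (take (i * L) v = take (i * L) w)) \<le> (1 / m) ^ (i * L)" .
  qed (use q f(1) in \<open>auto simp: b_def\<close>)
  also have "(\<Sum>i\<in>{j..<n}. b i * (\<Sum>v\<in>?T. f v * (1 / m) ^ (i * L))) = c * (\<Sum>i\<in>{j..<n}. b i * (1 / m) ^ (i * L))"
    unfolding sum_distrib_right[symmetric] f(2) by (simp add: sum_distrib_left ac_simps)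
  finally have EW2: "P.expectation (\<lambda>\<omega>. (W \<omega>)\<^sup>2) \<le> Q\<^sup>2 * (c\<^sup>2 + c * (\<Sum>i\<in>{j..<n}. b i * (1 / m) ^ (i * L)))" .
  define r where "r = 1 / (q * m ^ L)"
  have r: "0 < r" "r < 1" using q m qm by (auto simp: r_def)
  have geo: "(\<Sum>i\<in>{j..<n}. b i * (1 / m) ^ (i * L)) \<le> 1 / (q * (1 - r)) * (1 / m ^ L) ^ j"
  proof -
    have term_eq: "b i * (1 / m) ^ (i * L) = (1 / m ^ L) ^ j / q * r ^ (i - j)" if "i \<in> {j..<n}" for i
    proof -
      have "(1 / m) ^ (i * L) = (1 / m ^ L) ^ i"
        by (simp add: power_mult[symmetric] power_one_over mult.commute)
      also have "\<dots> = (1 / m ^ L) ^ j * (1 / m ^ L) ^ (i - j)"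
        using that by (simp flip: power_add)
      finally have 1: "(1 / m) ^ (i * L) = (1 / m ^ L) ^ j * (1 / m ^ L) ^ (i - j)" .
      have "b i = 1 / q * (1 / q) ^ (i - j)" using that by (simp add: b_def Suc_diff_le)
      moreover have "r ^ (i - j) = (1 / q) ^ (i - j) * (1 / m ^ L) ^ (i - j)"
        by (simp add: r_def flip: power_mult_distrib)
      ultimately show ?thesis unfolding 1 by simp
    qed
    have "(\<Sum>i\<in>{j..<n}. b i * (1 / m) ^ (i * L)) = (1 / m ^ L) ^ j / q * (\<Sum>i\<in>{j..<n}. r ^ (i - j))"
      by (simp add: term_eq sum_distrib_left)
    also have "(\<Sum>i\<in>{j..<n}. r ^ (i - j)) = (\<Sum>k<n - j. r ^ k)"
      by (rule sum.reindex_bij_witness[of _ "\<lambda>k. k + j" "\<lambda>i. i - j"]) auto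
    also have "\<dots> = (1 - r ^ (n - j)) / (1 - r)" using r by (simp add: sum_gp_strict)
    also have "(1 / m ^ L) ^ j / q * \<dots> \<le> (1 / m ^ L) ^ j / q * (1 / (1 - r))"
      using r q m by (intro mult_left_mono divide_right_mono) auto
    finally show ?thesis by (simp add: ac_simps)
  qed
  have "P.variance W = P.expectation (\<lambda>\<omega>. (W \<omega>)\<^sup>2) - (c * Q)\<^sup>2"
    unfolding P.variance_eq[OF P.square_integrable_imp_integrable[OF W_meas intW2] intW2] by (simp only: EW)
  also have "\<dots> \<le> Q\<^sup>2 * (c * (\<Sum>i\<in>{j..<n}. b i * (1 / m) ^ (i * L)))"
    using EW2 by (simp add: power_mult_distrib algebra_simps)
  also have "\<dots> \<le> Q\<^sup>2 * (c * (1 / (q * (1 - r)) * (1 / m ^ L) ^ j))"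
    using geo c by (intro mult_left_mono) auto
  finally have var: "P.variance W \<le> Q\<^sup>2 * (c * (1 / (q * (1 - r)) * (1 / m ^ L) ^ j))" .
  have f_le: "f v \<le> (1 / m) ^ (n * L)" if v: "v \<in> ?T" for v
  proof -
    have "f v \<le> (\<Sum>w\<in>{w \<in> ?T. take (length v) w = v}. f w)"
      using v f(1) level_length[OF v] by (intro member_le_sum) auto
    also have "\<dots> \<le> (1 / m) ^ (n * L)" using F[of v] level_length[OF v] by simp
    finally show ?thesis .
  qed
  have "{\<omega> \<in> space M. (\<Sum>v\<in>?T. indicator (open_from j n v) \<omega>) < c / 2 * (Q * m ^ (n * L))}
    \<subseteq> {\<omega> \<in> space M. c * Q / 2 \<le> \<bar>W \<omega> - P.expectation W\<bar>}"
  proof (intro Collect_mono impI conjI, simp, elim conjE)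
    fix \<omega> assume s: "(\<Sum>v\<in>?T. indicator (open_from j n v) \<omega>) < c / 2 * (Q * m ^ (n * L))"
    have "W \<omega> \<le> (\<Sum>v\<in>?T. (1 / m) ^ (n * L) * indicator (open_from j n v) \<omega>)"
      unfolding W_def using f_le by (intro sum_mono mult_right_mono) auto
    also have "\<dots> = (1 / m) ^ (n * L) * (\<Sum>v\<in>?T. indicator (open_from j n v) \<omega>)"
      by (simp add: sum_distrib_left)
    also have "\<dots> \<le> (1 / m) ^ (n * L) * (c / 2 * (Q * m ^ (n * L)))"
      using s m by (intro mult_left_mono) auto
    also have "\<dots> = c * Q / 2" using m by (simp add: power_one_over)
    finally show "c * Q / 2 \<le> \<bar>W \<omega> - P.expectation W\<bar>" unfolding EW by linarith
  qed
  then have "P.prob {\<omega> \<in> space M. (\<Sum>v\<in>?T. indicator (open_from j n v) \<omega>) < c / 2 * (Q * m ^ (n * L))}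
    \<le> P.prob {\<omega> \<in> space M. c * Q / 2 \<le> \<bar>W \<omega> - P.expectation W\<bar>}"
    using W_meas by (intro P.finite_measure_mono) auto
  also have "\<dots> \<le> P.variance W / (c * Q / 2)\<^sup>2"
    using c Q by (intro P.Chebyshev_inequality W_meas intW2) auto
  also have "\<dots> \<le> Q\<^sup>2 * (c * (1 / (q * (1 - r)) * (1 / m ^ L) ^ j)) / (c * Q / 2)\<^sup>2"
    by (intro divide_right_mono var) auto
  also have "\<dots> = 4 / (c * q * (1 - r)) * (1 / m ^ L) ^ j"
  proof -
    have "Q\<^sup>2 * (c * (1 / (q * d) * e)) / (c * Q / 2)\<^sup>2 = 4 / (c * q * d) * e" if "0 < d" for d e :: real
      using c Q q that by (simp add: power2_eq_square ac_simps)
    then show ?thesis using r by simp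
  qed
  finally show ?thesis unfolding r_def Q_def .
qed

end

section \<open>Divergence of the cascade\<close>

lemma min_entry_path_product_pos:
  assumes v: "v \<in> tree_level B n" and k: "1 \<le> k" "k \<le> n"
    and pos: "\<And>e. e \<in> tree_edges B \<Longrightarrow> 0 < min_entry (x e)"
  shows "0 < min_entry (path_product x v k)"
  using k
proof (induction k)
  case (Suc k)
  have "edge_to (take (Suc k) v) \<in> segment_edges v 0 n"
    using Suc.prems by (auto simp: segment_edges_def)
  then have e: "0 < min_entry (x (edge_to (take (Suc k) v)))"
    using segment_edges_subset[OF v, of 0 n] by (intro pos) auto
  show ?case
  proof (cases "k = 0")
    case True
    then show ?thesis using e by simp
  next
    case False
    then have "0 < min_entry (path_product x v k)" using Suc by auto
    then show ?thesis using e by (simp add: min_entry_mult_pos)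
  qed
qed simp

lemma cascade_Z_inf_infinite:
  fixes x :: "nat list \<times> nat list \<Rightarrow> real^'n^'n"
  assumes pos: "\<And>e. e \<in> tree_edges B \<Longrightarrow> 0 < min_entry (x e)"
    and unbounded: "\<And>H. \<exists>n\<ge>1. H \<le> (\<Sum>v\<in>tree_level B n. min_entry (path_product x v n))"
  shows "cascade_Z_inf B x = \<infinity>"
proof -
  have psi: "(\<Sum>v\<in>tree_level B n. min_entry (path_product x v n)) \<le> cascade_psi B x n $ i $ j" for n i j
  proof -
    have "cascade_psi B x n $ i $ j = (\<Sum>v\<in>tree_level B n. path_product x v n $ i $ j)"
      unfolding cascade_psi_def sum_component by (intro sum.cong) (auto simp: tree_level_def)
    then show ?thesis by (auto intro!: sum_mono min_entry_le)
  qed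
  have psi_nonneg: "0 \<le> cascade_psi B x n $ i $ j" if "1 \<le> n" for n i j
  proof -
    have "0 \<le> (\<Sum>v\<in>tree_level B n. min_entry (path_product x v n))"
      using min_entry_path_product_pos[OF _ that order_refl pos] by (intro sum_nonneg) (auto intro: less_imp_le)
    then show ?thesis using psi[of n i j] by linarith
  qed
  have zeta: "cascade_zeta B x n $ i $ j = (\<Sum>k=1..n. cascade_psi B x k $ i $ j)" for n i j
    by (simp add: cascade_zeta_def sum_component)
  have "lim (\<lambda>n. ereal (cascade_zeta B x n $ i $ j)) = \<infinity>" for i j
  proof (rule limI)
    have "LIM n sequentially. cascade_zeta B x n $ i $ j :> at_top"
      unfolding filterlim_at_top
    proof
      fix H
      obtain n where n: "1 \<le> n" "H \<le> (\<Sum>v\<in>tree_level B n. min_entry (path_product x v n))"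
        using unbounded by blast
      show "\<forall>\<^sub>F N in sequentially. H \<le> cascade_zeta B x N $ i $ j"
      proof (rule eventually_sequentiallyI[of n])
        fix N assume "n \<le> N"
        then have "cascade_psi B x n $ i $ j \<le> cascade_zeta B x N $ i $ j"
          unfolding zeta using n psi_nonneg by (intro member_le_sum) auto
        then show "H \<le> cascade_zeta B x N $ i $ j" using n psi[of n i j] by linarith
      qed
    qed
    then show "(\<lambda>n. ereal (cascade_zeta B x n $ i $ j)) \<longlonglongrightarrow> \<infinity>"
      by (simp add: tendsto_PInfty_eq_at_top)
  qed
  then show ?thesis by (simp add: cascade_Z_inf_def cascade_zeta_inf_def sum_Pinfty)
qed

context block_percolation
begin

lemma min_entry_open_path:
  assumes v: "v \<in> tree_level B (n * L)" and \<omega>: "\<omega> \<in> open_from j n v" and j: "j \<le> k" "k \<le> n"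
    and \<tau>: "0 < \<tau>" and pos: "0 \<le> min_entry (path_product (\<lambda>e. \<xi> e \<omega>) v (j * L))"
  shows "\<tau> ^ (k - j) * min_entry (path_product (\<lambda>e. \<xi> e \<omega>) v (j * L))
    \<le> min_entry (path_product (\<lambda>e. \<xi> e \<omega>) v (k * L))"
  using j
proof (induction k rule: dec_induct)
  case base
  then show ?case by simp
next
  case (step k)
  let ?S = "segment_product (\<lambda>e. \<xi> e \<omega>) v (k * L) L" and ?P = "\<lambda>k. path_product (\<lambda>e. \<xi> e \<omega>) v (k * L)"
  have good: "\<tau> \<le> min_entry ?S" using \<omega> step by (auto simp: open_from_def good_def)
  have IH: "\<tau> ^ (k - j) * min_entry (?P j) \<le> min_entry (?P k)" using step by simp
  have P0: "0 \<le> \<tau> ^ (k - j) * min_entry (?P j)" using \<tau> pos by simp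
  have "\<tau> ^ (Suc k - j) * min_entry (?P j) = \<tau> * (\<tau> ^ (k - j) * min_entry (?P j))"
    using step by (simp add: Suc_diff_le)
  also have "\<dots> \<le> min_entry ?S * min_entry (?P k)"
    using good IH \<tau> P0 by (intro mult_mono) auto
  also have "\<dots> \<le> min_entry (?S ** ?P k)"
    using good \<tau> IH P0 by (intro min_entry_mult) auto
  also have "?S ** ?P k = ?P (Suc k)"
    using path_product_add[of "\<lambda>e. \<xi> e \<omega>" v "k * L" L] by (simp add: add.commute)
  finally show ?case .
qed

text \<open>
  The factor \<open>a\<close> is the least entry over all path products to level \<open>j * L\<close>, positive because the
  level is finite, and capped at 1 to make sense of an empty level.
  The bound \<open>1 \<le> j\<close> excludes the empty product, whose least entry may be 0.
\<close>
lemma sum_min_entry_ge_open_paths: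
  assumes j: "1 \<le> j" and \<tau>: "0 < \<tau>" and \<omega>: "\<omega> \<in> space M"
    and pos: "\<And>e. e \<in> tree_edges B \<Longrightarrow> 0 < min_entry (\<xi> e \<omega>)"
  obtains a where "0 < a" "\<And>n. j \<le> n \<Longrightarrow>
    a * \<tau> ^ (n - j) * (\<Sum>v\<in>tree_level B (n * L). indicator (open_from j n v) \<omega>)
      \<le> (\<Sum>v\<in>tree_level B (n * L). min_entry (path_product (\<lambda>e. \<xi> e \<omega>) v (n * L)))"
proof -
  let ?P = "path_product (\<lambda>e. \<xi> e \<omega>)"
  define a where "a = Min (insert 1 ((\<lambda>u. min_entry (?P u (j * L))) ` tree_level B (j * L)))"
  have jL: "1 \<le> j * L" using j L_pos by simp
  have a: "0 < a"
    unfolding a_def using min_entry_path_product_pos[OF _ jL order_refl pos]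
    by (subst Min_gr_iff) auto
  have "a * \<tau> ^ (n - j) * (\<Sum>v\<in>tree_level B (n * L). indicator (open_from j n v) \<omega>)
      \<le> (\<Sum>v\<in>tree_level B (n * L). min_entry (?P v (n * L)))" if n: "j \<le> n" for n
    unfolding sum_distrib_left
  proof (rule sum_mono)
    fix v assume v: "v \<in> tree_level B (n * L)"
    have le: "j * L \<le> n * L" using n by simp
    have nL: "1 \<le> n * L" using jL le by linarith
    have a_le: "a \<le> min_entry (?P v (j * L))"
    proof -
      have "a \<le> min_entry (?P (take (j * L) v) (j * L))"
        unfolding a_def using take_in_tree_level[OF v le] by (intro Min_le) auto
      also have "?P (take (j * L) v) (j * L) = ?P v (j * L)"
        using segment_product_take[of 0 "j * L" "j * L" "\<lambda>e. \<xi> e \<omega>" v] path_product_add[of "\<lambda>e. \<xi> e \<omega>" _ 0 "j * L"]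
        by simp
      finally show ?thesis .
    qed
    show "a * \<tau> ^ (n - j) * indicator (open_from j n v) \<omega> \<le> min_entry (?P v (n * L))"
    proof (cases "\<omega> \<in> open_from j n v")
      case True
      have "a * \<tau> ^ (n - j) \<le> \<tau> ^ (n - j) * min_entry (?P v (j * L))"
        using a_le \<tau> by (simp add: mult.commute)
      also have "\<dots> \<le> min_entry (?P v (n * L))"
        using min_entry_open_path[OF v True n order_refl \<tau>] a a_le by simp
      finally show ?thesis using True by simp
    next
      case False
      then show ?thesis
        using min_entry_path_product_pos[OF v nL order_refl pos] by (simp add: less_imp_le)
    qed
  qed
  then show thesis using a that by blast
qed

text \<open>
  For fixed \<open>j\<close>, the event that from some level on there are always too few open vertices has
  probability of order \<open>m ^ (- j * L)\<close>, being an increasing union of events with this bound. Outside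
  the intersection of these events over \<open>j\<close>, which is null, some \<open>j\<close> has enough open vertices at infinitely many levels.
\<close>
lemma AE_cascade_infinite:
  assumes \<tau>: "0 < \<tau>" "\<tau> \<le> 1" and m: "0 < m" and super: "1 < q * \<tau> * m ^ L"
    and c: "0 < c" "\<And>n. c \<le> min_cut B m n []"
  shows "AE \<omega> in M. cascade_Z_inf B (\<lambda>e. \<xi> e \<omega>) = \<infinity>"
proof -
  have q1: "q \<le> 1" unfolding q_def by (rule C.prob_le_1)
  have q: "0 < q"
  proof (rule ccontr)
    assume "\<not> 0 < q"
    then have "q * \<tau> * m ^ L \<le> 0" using \<tau> m by (intro mult_nonpos_nonneg) (auto simp: mult_nonpos_nonneg)
    then show False using super by simp
  qed
  have qm: "1 < q * m ^ L"
  proof -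
    have "q * \<tau> * m ^ L \<le> q * 1 * m ^ L" using \<tau> q m by (intro mult_mono) auto
    then show ?thesis using super by simp
  qed
  have mL: "1 < m ^ L"
  proof -
    have "q * m ^ L \<le> 1 * m ^ L" using q1 m by (intro mult_right_mono) auto
    then show ?thesis using qm by simp
  qed
  define N where "N \<omega> j n = (\<Sum>v\<in>tree_level B (n * L). indicator (open_from j n v) \<omega> :: real)" for \<omega> j n
  define E where "E j n = {\<omega> \<in> space M. N \<omega> j n < c / 2 * (q ^ (n - j) * m ^ (n * L))}" for j n
  define F where "F j k = (\<Inter>n\<in>{k..}. E j n)" for j k
  define K where "K = 4 / (c * q * (1 - 1 / (q * m ^ L)))"
  have E_ev: "E j n \<in> sets M" for j n
  proof -
    have "(\<lambda>\<omega>. N \<omega> j n) \<in> borel_measurable M"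
      unfolding N_def by (intro borel_measurable_sum borel_measurable_indicator open_from_event)
    then show ?thesis unfolding E_def by measurable
  qed
  have F_ev: "F j k \<in> sets M" for j k
    unfolding F_def using E_ev by (intro sets.countable_INT) auto
  have F_prob: "P.prob (F j k) \<le> K * (1 / m ^ L) ^ j" for j k
  proof -
    have "P.prob (F j k) \<le> P.prob (E j (max j k))"
      using E_ev by (intro P.finite_measure_mono) (auto simp: F_def)
    also have "\<dots> \<le> K * (1 / m ^ L) ^ j"
      unfolding E_def N_def K_def using q m qm c by (intro few_open_paths_unlikely) auto
    finally show ?thesis .
  qed
  have UF_prob: "P.prob (\<Union>k. F j k) \<le> K * (1 / m ^ L) ^ j" for j
  proof (rule LIMSEQ_le_const2)
    show "(\<lambda>k. P.prob (F j k)) \<longlonglongrightarrow> P.prob (\<Union>k. F j k)"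
      using F_ev by (intro P.finite_Lim_measure_incseq) (auto simp: incseq_def F_def)
  qed (use F_prob in auto)
  define Z where "Z = (\<Inter>j\<in>{1..}. \<Union>k. F j k)"
  have UF_ev: "(\<Union>k. F j k) \<in> sets M" for j using F_ev by auto
  have Z_ev: "Z \<in> sets M" unfolding Z_def using UF_ev by (intro sets.countable_INT) auto
  have "P.prob Z \<le> 0"
  proof (rule LIMSEQ_le_const)
    have "(\<lambda>j. K * (1 / m ^ L) ^ j) \<longlonglongrightarrow> K * 0"
      using mL by (intro tendsto_mult_left LIMSEQ_power_zero) auto
    then show "(\<lambda>j. K * (1 / m ^ L) ^ j) \<longlonglongrightarrow> 0" by simp
    have "P.prob Z \<le> K * (1 / m ^ L) ^ j" if "1 \<le> j" for j
      using UF_prob[of j] P.finite_measure_mono[OF _ UF_ev[of j], of Z] that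
      by (auto simp: Z_def intro: order_trans)
    then show "\<exists>J. \<forall>j\<ge>J. P.prob Z \<le> K * (1 / m ^ L) ^ j" by blast
  qed
  then have "P.prob Z = 0" using measure_nonneg[of M Z] by linarith
  then have "AE \<omega> in M. \<omega> \<notin> Z"
    using Z_ev by (intro AE_not_in) (simp add: null_sets_def P.emeasure_eq_measure)
  with AE_xi_pos AE_space show ?thesis
  proof eventually_elim
    case (elim \<omega>)
    then obtain j where j: "1 \<le> j" "\<And>k. \<omega> \<notin> F j k" by (auto simp: Z_def)
    have pos: "0 < min_entry (\<xi> e \<omega>)" if "e \<in> tree_edges B" for e using elim that by auto
    obtain a where a: "0 < a" "\<And>n. j \<le> n \<Longrightarrow> a * \<tau> ^ (n - j) * N \<omega> j n
        \<le> (\<Sum>v\<in>tree_level B (n * L). min_entry (path_product (\<lambda>e. \<xi> e \<omega>) v (n * L)))"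
      using sum_min_entry_ge_open_paths[OF j(1) \<tau>(1) elim(2) pos] unfolding N_def by blast
    show ?case
    proof (rule cascade_Z_inf_infinite[OF pos])
      fix H :: real
      \<comment> \<open>The contribution of the open vertices at level \<open>n * L\<close> is at least \<open>b * (q * \<tau> * m ^ L) ^ (n - j)\<close>.\<close>
      define b where "b = a * (c / 2) * (m ^ L) ^ j"
      have b: "0 < b" using a c m by (simp add: b_def)
      obtain n0 where "H / b < (q * \<tau> * m ^ L) ^ n0" using real_arch_pow[OF super] by blast
      moreover obtain n where n: "max 1 j + n0 \<le> n" "\<omega> \<notin> E j n"
        using j(2)[of "max 1 j + n0"] by (auto simp: F_def)
      moreover have "(q * \<tau> * m ^ L) ^ n0 \<le> (q * \<tau> * m ^ L) ^ (n - j)"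
        using n(1) super by (intro power_increasing) auto
      ultimately have "H / b < (q * \<tau> * m ^ L) ^ (n - j)" by linarith
      then have "H \<le> b * (q * \<tau> * m ^ L) ^ (n - j)" using b by (simp add: field_simps)
      also have "\<dots> = a * \<tau> ^ (n - j) * (c / 2 * (q ^ (n - j) * m ^ (n * L)))"
      proof -
        have "m ^ (n * L) = (m ^ L) ^ j * (m ^ L) ^ (n - j)"
          using n(1) by (simp add: mult.commute[of n] power_mult flip: power_add)
        then show ?thesis by (simp add: b_def power_mult_distrib)
      qed
      also have "\<dots> \<le> a * \<tau> ^ (n - j) * N \<omega> j n"
        using n(2) elim(2) a \<tau> by (intro mult_left_mono) (auto simp: E_def)
      also have "\<dots> \<le> (\<Sum>v\<in>tree_level B (n * L). min_entry (path_product (\<lambda>e. \<xi> e \<omega>) v (n * L)))"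
        using n by (intro a) auto
      finally show "\<exists>n\<ge>1. H \<le> (\<Sum>v\<in>tree_level B n. min_entry (path_product (\<lambda>e. \<xi> e \<omega>) v n))"
        using n(1) L_pos by (intro exI[of _ "n * L"]) (auto simp: Suc_le_eq)
    qed
  qed
qed

end

theorem theorem3p2:
  fixes B :: "nat list \<Rightarrow> nat"
    and \<mu> :: "(real^'n^'n) measure"
    and M :: "'w measure"
    and \<xi> :: "nat list \<times> nat list \<Rightarrow> 'w \<Rightarrow> real^'n^'n"
  assumes no_extinction: "tree_boundary B \<noteq> {}"
    and bounded_branching: "bdd_above (B ` tree_vertices B)"
    and mu_prob: "prob_space \<mu>"
    and mu_sets: "sets \<mu> = sets GL_borel"
    and cond1: "moments_condition \<mu>"
    and cond2: "strong_irreducibility \<mu>"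
    and cond3: "strict_positivity \<mu>"
    and M_prob: "prob_space M"
    and xi_indep: "prob_space.indep_vars M (\<lambda>_. GL_borel) \<xi> (tree_edges B)"
    and xi_law: "\<And>a. a \<in> tree_edges B \<Longrightarrow> distr M GL_borel (\<xi> a) = \<mu>"
    and supercritical: "(INF s\<in>{0..1}. k_rate \<mu> s) * branching_rate B > 1"
  shows "AE \<omega> in M. cascade_Z_inf B (\<lambda>a. \<xi> a \<omega>) = \<infinity>"
proof -
  interpret mu: prob_space \<mu> by (rule mu_prob)
  interpret positive_matrix_law \<mu>
    by unfold_locales (use mu_sets cond1 strict_positivity_AE_min_entry[OF mu_sets cond3] in auto)
  interpret M: prob_space M by (rule M_prob)
  define lam where "lam = (INF s\<in>{0..1}. k_rate \<mu> s)"
  have br: "0 < branching_rate B" by (simp add: branching_rate_def)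
  have lam_br: "1 < lam * branching_rate B" using supercritical by (simp add: lam_def)
  then have lam: "0 < lam" using br by (metis less_trans zero_less_mult_pos2 zero_less_one)
  have bdd: "bdd_below (k_rate \<mu> ` {0..1})"
    by (rule bdd_belowI2[of _ 0]) (simp add: k_rate_power_le_moment(1))
  have lam_le: "lam \<le> k_rate \<mu> s" if "s \<in> {0..1}" for s
    unfolding lam_def by (rule cINF_lower[OF bdd that])
  have lam1: "lam \<le> 1" using lam_le[of 0] k_rate_0_le_1 by simp
  have "1 / lam < branching_rate B" using lam_br lam by (simp add: field_simps)
  then obtain m where m: "1 / lam < m" "m < branching_rate B" using dense by blast
  have lam_m: "1 < lam * m" using m(1) lam by (simp add: field_simps)
  have m1: "1 < m"
  proof -
    have "1 \<le> 1 / lam" using lam lam1 by simp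
    then show ?thesis using m by linarith
  qed
  obtain L \<tau> where L: "1 \<le> L" and \<tau>: "0 < \<tau>" "\<tau> \<le> 1"
    and super: "1 < measure (conv L) {g \<in> GL. \<tau> \<le> min_entry g} * \<tau> * m ^ L"
    using supercritical_block_exists[OF lam lam_le lam_m] by blast
  obtain c where c: "0 < c" "\<And>n. c \<le> min_cut B m n []"
    using min_cut_bounded_below[OF m1 m(2)] by blast
  interpret block_percolation \<mu> M B \<xi> L \<tau> "measure (conv L) {g \<in> GL. \<tau> \<le> min_entry g}"
    by unfold_locales (use xi_indep xi_law L in auto)
  show ?thesis
    by (rule AE_cascade_infinite[OF \<tau> _ super c]) (use m1 in simp)
qed

end
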